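(* Let $\lambda=(\lambda_1,\dots,\lambda_t)\vdash k$ and $\nu\vdash m$ be fixed partitions. Then the character value $$\chi^{(n,\lambda)}_{(\nu,1^{n+k-m})}$$ is a polynomial in $n$; that is, there is a polynomial with rational coefficients whose value at $n$ equals $\chi^{(n,\lambda)}_{(\nu,1^{n+k-m})}$ for all integers $n$ with $n\ge\lambda_1$ and $n+k\ge m$.
   Context: $(n,\lambda):=(n,\lambda_1,\dots,\lambda_t)$, a partition of $n+k$ (for $n\ge\lambda_1$). For a partition $\mu\vdash N$, $\chi^\mu$ is the irreducible complex character of the symmetric group $S_N$ indexed by $\mu$, and $\chi^\mu_\alpha$ denotes its value on permutations of cycle type $\alpha\vdash N$. Writing $\nu=(1^{a_1},2^{a_2},\dots,m^{a_m})\vdash m$ for the partition with $a_i$ parts of size $i$, one sets $(\nu,1^d):=(1^{a_1+d},2^{a_2},\dots,m^{a_m})\vdash m+d$, i.e. $d$ additional parts equal to $1$ are appended to $\nu$. *)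

theory Defs
  imports
    Complex_Main
    "HOL-Library.Function_Algebras"
    "HOL-Library.Multiset"
    "HOL-Combinatorics.Combinatorics"
    "HOL-Computational_Algebra.Polynomial"
begin

section \<open>Trace of a linear endomorphism of a subspace\<close>

context vector_space
begin

text \<open>
  Trace of \<open>f\<close> on a finite-dimensional subspace \<open>V\<close> with \<open>f ` V \<subseteq> V\<close>: the sum of the diagonal
  entries of the matrix of \<open>f\<close> with respect to a basis of \<open>V\<close>.
\<close>

definition trace_on :: "'b set \<Rightarrow> ('b \<Rightarrow> 'b) \<Rightarrow> 'a" where
  "trace_on V f =
    (let B = (SOME B. independent B \<and> span B = V) in \<Sum>b\<in>B. representation B (f b) b)"

end

text \<open>Complex-valued functions on \<open>'a\<close>, with the pointwise operations.\<close>

global_interpretation cfun: vector_space "\<lambda>(c :: complex) (f :: 'a \<Rightarrow> complex) x. c * f x"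
  by standard (simp_all add: fun_eq_iff algebra_simps)

section \<open>Partitions and cycle types\<close>

definition is_partition :: "nat list \<Rightarrow> nat \<Rightarrow> bool" where
  "is_partition mu N \<longleftrightarrow> sorted_wrt (\<ge>) mu \<and> 0 \<notin> set mu \<and> sum_list mu = N"

text \<open>Fixed points count as cycles of length 1.\<close>

definition cycle_type :: "nat \<Rightarrow> (nat \<Rightarrow> nat) \<Rightarrow> nat multiset" where
  "cycle_type N \<sigma> = image_mset card (mset_set (orbit \<sigma> ` {1..N}))"

section \<open>Specht modules and the irreducible characters of the symmetric groups\<close>

text \<open>
  The symmetric group \<open>S\<^sub>N\<close> is the set of all \<open>\<sigma>\<close> with \<open>\<sigma> permutes {1..N}\<close>.
  A shape is a weakly decreasing list \<open>\<mu>\<close> of natural numbers, and \<open>N = sum_list \<mu>\<close>; trailing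
  zeros in \<open>\<mu>\<close> are allowed and denote empty rows. Rows and columns are numbered from 0.
\<close>

definition cells :: "nat list \<Rightarrow> (nat \<times> nat) set" where
  "cells mu = {(i, j). i < length mu \<and> j < mu ! i}"

definition is_tableau :: "nat list \<Rightarrow> (nat \<times> nat \<Rightarrow> nat) \<Rightarrow> bool" where
  "is_tableau mu t \<longleftrightarrow> bij_betw t (cells mu) {1..sum_list mu}"

text \<open>The tabloid of a tableau is the list of the sets of entries of its rows.\<close>

definition tabloid :: "nat list \<Rightarrow> (nat \<times> nat \<Rightarrow> nat) \<Rightarrow> nat set list" where
  "tabloid mu t = map (\<lambda>i. {t (i, j) | j. j < mu ! i}) [0..<length mu]"

definition column :: "nat list \<Rightarrow> (nat \<times> nat \<Rightarrow> nat) \<Rightarrow> nat \<Rightarrow> nat set" where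
  "column mu t j = {t (i, j) | i. (i, j) \<in> cells mu}"

definition column_stabilizer :: "nat list \<Rightarrow> (nat \<times> nat \<Rightarrow> nat) \<Rightarrow> (nat \<Rightarrow> nat) set" where
  "column_stabilizer mu t =
    {\<pi>. \<pi> permutes {1..sum_list mu} \<and> (\<forall>j. \<pi> ` column mu t j = column mu t j)}"

text \<open>
  Elements of the permutation module \<open>M\<^sup>\<mu>\<close> are represented as coefficient functions on tabloids.
  The polytabloid of \<open>t\<close> is the signed sum, over the column stabilizer, of the basis vectors of
  \<open>M\<^sup>\<mu>\<close> given by the tabloids of \<open>\<pi> \<circ> t\<close>.
\<close>

definition polytabloid :: "nat list \<Rightarrow> (nat \<times> nat \<Rightarrow> nat) \<Rightarrow> nat set list \<Rightarrow> complex" where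
  "polytabloid mu t =
    (\<Sum>\<pi>\<in>column_stabilizer mu t.
       (\<lambda>T. if T = tabloid mu (\<pi> \<circ> t) then of_int (sign \<pi>) else 0))"

definition specht_module :: "nat list \<Rightarrow> (nat set list \<Rightarrow> complex) set" where
  "specht_module mu = cfun.span {polytabloid mu t | t. is_tableau mu t}"

text \<open>The linear action with \<open>\<sigma> \<cdot> \<delta>\<^sub>T = \<delta>\<^bsub>\<sigma>T\<^esub>\<close>, whence the inverse.\<close>

definition perm_act :: "(nat \<Rightarrow> nat) \<Rightarrow> (nat set list \<Rightarrow> complex) \<Rightarrow> nat set list \<Rightarrow> complex" where
  "perm_act \<sigma> f = (\<lambda>T. f (map ((`) (inv \<sigma>)) T))"

definition irr_char :: "nat list \<Rightarrow> (nat \<Rightarrow> nat) \<Rightarrow> complex" where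
  "irr_char mu \<sigma> = cfun.trace_on (specht_module mu) (perm_act \<sigma>)"

text \<open>The value \<open>\<chi>\<^sup>\<mu>\<^sub>\<alpha>\<close>: the common value of the class function \<open>\<chi>\<^sup>\<mu>\<close> on cycle type \<open>\<alpha>\<close>.\<close>

definition irr_char_at :: "nat list \<Rightarrow> nat list \<Rightarrow> complex" where
  "irr_char_at mu \<alpha> =
    (THE c. \<forall>\<sigma>. \<sigma> permutes {1..sum_list mu} \<and> cycle_type (sum_list mu) \<sigma> = mset \<alpha>
       \<longrightarrow> irr_char mu \<sigma> = c)"

end

theory Submission
  imports Defs
begin

text \<open>
Let \<open>\<mu> = (n, \<lambda>)\<close>, let \<open>R\<close> and \<open>C\<close> be the groups of permutations of the cells of \<open>\<mu>\<close> that preserve the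
rows and the columns, and let \<open>\<kappa>\<rho>\<close> be the Young symmetrizer, the sum of \<open>sgn q \<cdot> q p\<close> over \<open>q \<in> C\<close> and
\<open>p \<in> R\<close>. A function on the permutations of the cells that is alternating under \<open>C\<close> from the left and
invariant under \<open>R\<close> from the right is a multiple of the coefficient function of \<open>\<kappa>\<rho>\<close>; this holds
because a permutation that sends distinct cells of a row to distinct columns lies in \<open>CR\<close>
(\<open>col_row_factorisation\<close>). In particular \<open>(\<kappa>\<rho>)\<^sup>2 = c \<kappa>\<rho>\<close> for an integer \<open>c\<close>, and \<open>c > 0\<close> because a
positive multiple of \<open>c\<close> is a nonzero sum of squares (\<open>young_scalar_pos\<close>).

Map a tabloid to the sum of the polytabloids of its tableaux. This equivariant map from the
permutation module to the Specht module acts on the latter as the scalar \<open>c\<close>, so \<open>c\<close> times the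
character at \<open>\<sigma>\<close> is the trace of the composite with \<open>\<sigma>\<close> on the permutation module, which can be
read off on tabloids (\<open>irr_char_formula\<close>):
\<open>c \<cdot> \<chi>(\<sigma>) = \<Sum>q\<in>C. sgn q \<cdot> #{t. \<sigma> \<circ> t \<circ> q and t have the same tabloid}\<close>. The formula also shows that
\<open>\<chi>\<close> is constant on cycle types.

Now let \<open>n\<close> vary with \<open>n \<ge> \<lambda>\<^sub>1\<close>. Columns to the right of \<open>\<lambda>\<^sub>1\<close> have a single cell, so \<open>C\<close> permutes a fixed
finite set \<open>A\<close> of cells and does not depend on \<open>n\<close>. Both \<open>c\<close> and the right-hand side are signed sums,
over index sets that do not depend on \<open>n\<close>, of numbers of bijections \<open>A \<union> B \<rightarrow> A' \<union> B'\<close>. Here \<open>A'\<close> is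
fixed as well (it is \<open>A\<close> for \<open>c\<close>, and for the character it is the set \<open>{1..m}\<close> that carries a permutation
of cycle type \<open>\<nu>\<close>), and the condition that is counted only depends on the partial injection from \<open>A\<close> to
\<open>A'\<close> that the bijection induces. The number of bijections that induce a given partial injection of
size \<open>s\<close> is \<open>|B'|!\<close> times the falling factorial of \<open>|B|\<close> of length \<open>|A'| - s\<close>
(\<open>card_bijs_overlap\<close>). Hence \<open>c = (n - \<lambda>\<^sub>1)! P(n)\<close> and the right-hand side is
\<open>(n + k - m)! Q(n)\<close> with polynomials \<open>P\<close> and \<open>Q\<close>, so that the character value is a rational function of
\<open>n\<close> whose denominator does not vanish on the range in question.

Finally the character value is an integer, because the integral combinations of polytabloids form
a lattice that is stable under the group and has a basis (\<open>int_lattice_basis\<close>). A rational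
function over the rationals that takes integer values at all large \<open>n\<close> is a polynomial
(\<open>integer_valued_quotient_is_poly\<close>): after clearing denominators, the proper fractional part takes
integer values that tend to 0.
\<close>

section \<open>Traces and integral lattices in function spaces\<close>

lemma sum_fun_apply: "(\<Sum>s\<in>S. g s) x = (\<Sum>s\<in>S. g s x)" for g :: "'i \<Rightarrow> 'a \<Rightarrow> complex"
  by (induction S rule: infinite_finite_induct) auto

text \<open>
This is the identity \<open>tr (f \<Theta>) = tr (\<Theta> f)\<close> for the map \<open>\<Theta> v = \<Sum>s\<in>I. v (key s) \<cdot> e s\<close>, which is assumed to
act on \<open>V\<close> as the scalar \<open>c\<close>. As the right-hand side does not mention \<open>B\<close>, it also shows, for
\<open>c \<noteq> 0\<close>, that the trace does not depend on the basis.
\<close>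

lemma basis_trace_eq:
  fixes f :: "('a \<Rightarrow> complex) \<Rightarrow> 'a \<Rightarrow> complex" and e :: "'i \<Rightarrow> 'a \<Rightarrow> complex"
  assumes f_add: "\<And>u v. f (u + v) = f u + f v"
    and f_scale: "\<And>a u. f (\<lambda>x. a * u x) = (\<lambda>x. a * f u x)"
    and f_into: "\<And>v. v \<in> V \<Longrightarrow> f v \<in> V"
    and e_in: "\<And>s. s \<in> I \<Longrightarrow> e s \<in> V"
    and scalar: "\<And>v. v \<in> V \<Longrightarrow> (\<Sum>s\<in>I. (\<lambda>x. v (key s) * e s x)) = (\<lambda>x. c * v x)"
    and B: "finite B" "cfun.independent B" "cfun.span B = V"
  shows "c * (\<Sum>b\<in>B. cfun.representation B (f b) b) = (\<Sum>s\<in>I. f (e s) (key s))"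
proof -
  have f_zero: "f 0 = 0"
    using f_add[of 0 0] by simp
  have f_sum: "f (\<Sum>s\<in>S. g s) = (\<Sum>s\<in>S. f (g s))" for g :: "'i \<Rightarrow> 'a \<Rightarrow> complex" and S
    using additive.sum[of f g S] f_add by (simp add: additive_def)
  let ?rep = "cfun.representation B"
  have fe: "f (e s) \<in> cfun.span B" if "s \<in> I" for s
    using f_into[OF e_in[OF that]] B by simp
  have "c * ?rep (f b) b = (\<Sum>s\<in>I. ?rep (f (e s)) b * b (key s))" if "b \<in> B" for b
  proof -
    have bV: "b \<in> V" using B(3) cfun.span_base[OF that] by simp
    have "c * ?rep (f b) b = ?rep (\<lambda>x. c * f b x) b"
      using cfun.representation_scale[OF B(2)] f_into[OF bV] B(3) by simp
    also have "(\<lambda>x. c * f b x) = f (\<Sum>s\<in>I. (\<lambda>x. b (key s) * e s x))"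
      by (simp add: f_scale scalar[OF bV])
    also have "\<dots> = (\<Sum>s\<in>I. (\<lambda>x. b (key s) * f (e s) x))"
      by (simp add: f_sum f_scale)
    also have "?rep \<dots> b = (\<Sum>s\<in>I. ?rep (\<lambda>x. b (key s) * f (e s) x) b)"
      by (subst cfun.representation_sum[OF B(2)]) (auto intro!: cfun.span_scale fe)
    also have "\<dots> = (\<Sum>s\<in>I. ?rep (f (e s)) b * b (key s))"
      by (intro sum.cong refl) (simp add: cfun.representation_scale[OF B(2) fe])
    finally show ?thesis .
  qed
  then have "c * (\<Sum>b\<in>B. ?rep (f b) b) = (\<Sum>b\<in>B. \<Sum>s\<in>I. ?rep (f (e s)) b * b (key s))"
    by (simp add: sum_distrib_left)
  also have "\<dots> = (\<Sum>s\<in>I. \<Sum>b\<in>B. ?rep (f (e s)) b * b (key s))"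
    by (rule sum.swap)
  also have "\<dots> = (\<Sum>s\<in>I. f (e s) (key s))"
  proof (intro sum.cong refl)
    fix s assume "s \<in> I"
    from cfun.sum_representation_eq[OF B(2) fe[OF this] B(1) order_refl]
    have "(\<Sum>b\<in>B. (\<lambda>x. ?rep (f (e s)) b * b x)) (key s) = f (e s) (key s)" by simp
    then show "(\<Sum>b\<in>B. ?rep (f (e s)) b * b (key s)) = f (e s) (key s)"
      by (simp add: sum_fun_apply)
  qed
  finally show ?thesis .
qed

text \<open>
Echelon form, one coordinate at a time: the values of the lattice at a coordinate \<open>y\<close> form a
subgroup of the integers, hence are the multiples of some \<open>d\<close>. If \<open>d > 0\<close>, a vector with value \<open>d\<close> at \<open>y\<close>
extends a basis of the sublattice of vectors that vanish at \<open>y\<close>.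
\<close>

lemma int_lattice_basis:
  fixes L :: "('a \<Rightarrow> complex) set"
  assumes "finite X"
    and "0 \<in> L" "\<And>u v. u \<in> L \<Longrightarrow> v \<in> L \<Longrightarrow> u - v \<in> L"
    and "\<And>v x. v \<in> L \<Longrightarrow> v x \<in> \<int>" and "\<And>v x. v \<in> L \<Longrightarrow> x \<notin> X \<Longrightarrow> v x = 0"
  shows "\<exists>B\<subseteq>L. finite B \<and> cfun.independent B \<and>
           (\<forall>v\<in>L. \<exists>z :: ('a \<Rightarrow> complex) \<Rightarrow> int. v = (\<Sum>b\<in>B. (\<lambda>x. of_int (z b) * b x)))"
  using assms
proof (induction X arbitrary: L)
  case empty
  have "v = 0" if "v \<in> L" for v
    using empty.prems(4)[OF that] by (auto simp: fun_eq_iff)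
  then have "L \<subseteq> {0}" by blast
  then show ?case
    by (intro exI[of _ "{}"]) (auto simp: cfun.independent_empty simp del: zero_fun_apply)
next
  case (insert y X)
  define L' where "L' = {v \<in> L. v y = 0}"
  have "\<exists>B\<subseteq>L'. finite B \<and> cfun.independent B \<and>
           (\<forall>v\<in>L'. \<exists>z :: ('a \<Rightarrow> complex) \<Rightarrow> int. v = (\<Sum>b\<in>B. (\<lambda>x. of_int (z b) * b x)))"
  proof (rule insert.IH)
    show "v x = 0" if "v \<in> L'" "x \<notin> X" for v x
      using insert.prems(4)[of v x] that by (cases "x = y") (auto simp: L'_def)
  qed (use insert.prems in \<open>auto simp: L'_def\<close>)
  then obtain B where B: "B \<subseteq> L'" "finite B" "cfun.independent B"
    and Bz: "\<And>v. v \<in> L' \<Longrightarrow> \<exists>z :: ('a \<Rightarrow> complex) \<Rightarrow> int. v = (\<Sum>b\<in>B. (\<lambda>x. of_int (z b) * b x))"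
    by blast
  show ?case
  proof (cases "\<forall>v\<in>L. v y = 0")
    case True
    then have "L' = L" by (auto simp: L'_def)
    then show ?thesis using B Bz by blast
  next
    case False
    have neg: "- v \<in> L" if "v \<in> L" for v
      using insert.prems(2)[OF insert.prems(1) that] by (simp add: fun_Compl_def)
    have add: "u + v \<in> L" if "u \<in> L" "v \<in> L" for u v
      using insert.prems(2)[OF that(1) neg[OF that(2)]] by (simp add: plus_fun_def fun_Compl_def)
    have mult_nat: "(\<lambda>x. of_nat n * v x) \<in> L" if "v \<in> L" for n v
    proof (induction n)
      case 0
      then show ?case using insert.prems(1) by (simp add: zero_fun_def)
    next
      case (Suc n)
      from add[OF that this] show ?case by (simp add: plus_fun_def algebra_simps)
    qed
    have mult_int: "(\<lambda>x. of_int k * v x) \<in> L" if "v \<in> L" for k v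
    proof (cases k rule: int_cases2)
      case (nonneg n)
      then show ?thesis using mult_nat[OF that, of n] by simp
    next
      case (nonpos n)
      then show ?thesis using neg[OF mult_nat[OF that, of n]] by (simp add: fun_Compl_def)
    qed
    define P where "P n \<longleftrightarrow> n > 0 \<and> (\<exists>v\<in>L. v y = of_nat n)" for n :: nat
    \<comment> \<open>some value at y is nonzero, and the lattice is closed under negation\<close>
    have "\<exists>n. P n"
    proof -
      from False obtain v where v: "v \<in> L" "v y \<noteq> 0" by auto
      from insert.prems(3)[OF v(1), of y] obtain k where k: "v y = of_int k" by (auto elim: Ints_cases)
      show ?thesis
      proof (cases k rule: int_cases2)
        case (nonneg n)
        then show ?thesis using v k by (intro exI[of _ n]) (auto simp: P_def)
      next
        case (nonpos n)
        then show ?thesis using v k neg[OF v(1)]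
          by (intro exI[of _ n]) (auto simp: P_def intro!: bexI[of _ "-v"])
      qed
    qed
    then have "P (LEAST n. P n)" by (rule LeastI_ex)
    then obtain d b0 where d: "d = (LEAST n. P n)" "d > 0" and b0: "b0 \<in> L" "b0 y = of_nat d"
      unfolding P_def by blast
    \<comment> \<open>division with remainder by d: the remainder is a smaller value at y, so it is 0\<close>
    have quot: "\<exists>k. v - (\<lambda>x. of_int k * b0 x) \<in> L'" if v: "v \<in> L" for v
    proof -
      from insert.prems(3)[OF v, of y] obtain a where a: "v y = of_int a" by (auto elim: Ints_cases)
      define w where "w = v - (\<lambda>x. of_int (a div int d) * b0 x)"
      have wL: "w \<in> L"
        unfolding w_def by (intro insert.prems(2) v mult_int b0)
      have "w y = of_int (a - a div int d * int d)"
        by (simp add: w_def a b0)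
      then have wy: "w y = of_nat (nat (a mod int d))"
        using d(2) by (simp add: minus_div_mult_eq_mod)
      have "nat (a mod int d) = 0"
      proof (rule ccontr)
        assume "nat (a mod int d) \<noteq> 0"
        then have "P (nat (a mod int d))" using wL wy by (auto simp: P_def)
        then have "d \<le> nat (a mod int d)" unfolding d(1) by (rule Least_le)
        moreover have "a mod int d < int d" using d(2) by simp
        ultimately show False using d(2) by linarith
      qed
      then have "w \<in> L'" using wL wy by (simp add: L'_def)
      then show ?thesis unfolding w_def by blast
    qed
    have span_B: "v y = 0" if "v \<in> cfun.span B" for v
      using that
    proof (induction rule: cfun.span_induct_alt)
      case (step c u v)
      then show ?case using B(1) by (auto simp: L'_def)
    qed simp
    have b0B: "b0 \<notin> cfun.span B" using span_B[of b0] b0 d(2) by auto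
    then have b0B': "b0 \<notin> B" using cfun.span_base by blast
    show ?thesis
    proof (intro exI[of _ "insert b0 B"] conjI ballI)
      show "insert b0 B \<subseteq> L" using B(1) b0 by (auto simp: L'_def)
      show "finite (insert b0 B)" using B by simp
      show "cfun.independent (insert b0 B)"
        using cfun.independent_insertI[OF b0B B(3)] .
      fix v assume v: "v \<in> L"
      from quot[OF v] obtain k where k: "v - (\<lambda>x. of_int k * b0 x) \<in> L'" by blast
      from Bz[OF this] obtain z where z: "v - (\<lambda>x. of_int k * b0 x) = (\<Sum>b\<in>B. (\<lambda>x. of_int (z b) * b x))"
        by blast
      have "v = (\<lambda>x. of_int k * b0 x) + (\<Sum>b\<in>B. (\<lambda>x. of_int (z b) * b x))"
        using z by (simp add: algebra_simps)
      also have "\<dots> = (\<Sum>b\<in>insert b0 B. (\<lambda>x. of_int ((z(b0 := k)) b) * b x))"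
        using b0B' B(2) by (subst sum.insert) (auto intro!: sum.cong)
      finally show "\<exists>z :: ('a \<Rightarrow> complex) \<Rightarrow> int. v = (\<Sum>b\<in>insert b0 B. (\<lambda>x. of_int (z b) * b x))"
        by blast
    qed
  qed
qed

lemma representation_combination:
  assumes B: "finite B" "cfun.independent B" and v: "v = (\<Sum>b\<in>B. (\<lambda>x. z b * b x))" and "b \<in> B"
  shows "cfun.representation B v b = z b"
proof -
  have "cfun.representation B v b = (\<Sum>b'\<in>B. cfun.representation B (\<lambda>x. z b' * b' x) b)"
    unfolding v by (subst cfun.representation_sum[OF B(2)]) (auto intro: cfun.span_scale cfun.span_base)
  also have "\<dots> = (\<Sum>b'\<in>B. z b' * (if b = b' then 1 else 0))"
    by (intro sum.cong refl)
       (simp add: cfun.representation_scale[OF B(2) cfun.span_base] cfun.representation_basis[OF B(2)])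
  also have "\<dots> = z b" using B(1) \<open>b \<in> B\<close> by (simp add: sum.delta if_distrib cong: if_cong)
  finally show ?thesis .
qed

text \<open>
The two facts about traces that the character needs. The second one evaluates the trace in a
basis of the lattice spanned by the vectors \<open>e s\<close>, in which the matrix of \<open>f\<close> is integral; the
scalar \<open>c\<close> enters it only through the independence of the basis.
\<close>

lemma trace_on_eq_and_Ints:
  fixes f :: "('a \<Rightarrow> complex) \<Rightarrow> 'a \<Rightarrow> complex" and e :: "'i \<Rightarrow> 'a \<Rightarrow> complex"
  assumes f_add: "\<And>u v. f (u + v) = f u + f v"
    and f_scale: "\<And>a u. f (\<lambda>x. a * u x) = (\<lambda>x. a * f u x)"
    and f_into: "\<And>s. s \<in> I \<Longrightarrow> f (e s) \<in> e ` I"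
    and I: "finite I" and X: "finite X"
    and e_int: "\<And>s x. s \<in> I \<Longrightarrow> e s x \<in> \<int>" and e_supp: "\<And>s x. s \<in> I \<Longrightarrow> x \<notin> X \<Longrightarrow> e s x = 0"
    and scalar: "\<And>t. t \<in> I \<Longrightarrow> (\<Sum>s\<in>I. (\<lambda>x. e t (key s) * e s x)) = (\<lambda>x. c * e t x)"
    and c: "c \<noteq> 0"
  shows "c * cfun.trace_on (cfun.span (e ` I)) f = (\<Sum>s\<in>I. f (e s) (key s))"
    and "cfun.trace_on (cfun.span (e ` I)) f \<in> \<int>"
proof -
  define V where "V = cfun.span (e ` I)"
  have f_zero: "f 0 = 0"
    using f_add[of 0 0] by simp
  have f_sum: "f (\<Sum>s\<in>S. g s) = (\<Sum>s\<in>S. f (g s))" for g :: "'i \<Rightarrow> 'a \<Rightarrow> complex" and S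
    using additive.sum[of f g S] f_add by (simp add: additive_def)
  have fV: "f v \<in> V" if "v \<in> V" for v
    using that unfolding V_def
  proof (induction rule: cfun.span_induct_alt)
    case base
    then show ?case using cfun.span_zero[of "e ` I"] by (simp only: f_zero)
  next
    case (step a u v)
    then have "f u \<in> e ` I" using f_into by auto
    then show ?case unfolding f_add f_scale
      by (intro cfun.span_add cfun.span_scale step cfun.span_base)
  qed
  have scal: "(\<Sum>s\<in>I. (\<lambda>x. v (key s) * e s x)) = (\<lambda>x. c * v x)" if "v \<in> V" for v
    using that unfolding V_def
  proof (induction rule: cfun.span_induct_alt)
    case base
    then show ?case by (simp add: sum_fun_apply zero_fun_def)
  next
    case (step a u v)
    then have "(\<Sum>s\<in>I. (\<lambda>x. u (key s) * e s x)) = (\<lambda>x. c * u x)" using scalar by auto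
    then have "(\<Sum>s\<in>I. u (key s) * e s x) = c * u x" for x by (simp add: sum_fun_apply fun_eq_iff)
    moreover from step(2) have "(\<Sum>s\<in>I. v (key s) * e s x) = c * v x" for x
      by (simp add: sum_fun_apply fun_eq_iff)
    ultimately show ?case
      by (simp add: sum_fun_apply fun_eq_iff algebra_simps sum.distrib flip: sum_distrib_left)
  qed
  have key: "c * (\<Sum>b\<in>B. cfun.representation B (f b) b) = (\<Sum>s\<in>I. f (e s) (key s))"
    if "cfun.independent B" "cfun.span B = V" for B
  proof (rule basis_trace_eq[where V = V])
    have "finite B \<and> card B \<le> card (e ` I)"
      using that cfun.span_superset[of B] I
      by (intro cfun.independent_span_bound) (auto simp: V_def)
    then show "finite B" by simp
  qed (use that f_add f_scale fV scal in \<open>auto simp: V_def intro: cfun.span_base\<close>)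

  define L where "L = {\<Sum>s\<in>I. (\<lambda>x. of_int (z s) * e s x) | z :: 'i \<Rightarrow> int. True}"
  have eL: "e s \<in> L" if "s \<in> I" for s
  proof -
    have "(\<Sum>s'\<in>I. (\<lambda>x. of_int (if s' = s then 1 else 0) * e s' x)) = e s"
      using I that by (simp add: sum_fun_apply fun_eq_iff if_distrib[where f = of_int] if_distribR
          if_distrib[where f = "\<lambda>z. z * _"] cong: if_cong)
    then show ?thesis unfolding L_def by (intro CollectI exI[of _ "\<lambda>s'. if s' = s then 1 else 0"]) simp
  qed
  have Ldiff: "u - v \<in> L" if "u \<in> L" "v \<in> L" for u v
  proof -
    from that obtain z z' :: "'i \<Rightarrow> int" where
      "u = (\<Sum>s\<in>I. (\<lambda>x. of_int (z s) * e s x))" "v = (\<Sum>s\<in>I. (\<lambda>x. of_int (z' s) * e s x))"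
      by (auto simp: L_def)
    then have "u - v = (\<Sum>s\<in>I. (\<lambda>x. of_int (z s - z' s) * e s x))"
      by (simp add: sum_fun_apply fun_eq_iff algebra_simps sum_subtractf)
    then show ?thesis unfolding L_def by (intro CollectI exI[of _ "\<lambda>s. z s - z' s"]) simp
  qed
  have L0: "0 \<in> L"
    unfolding L_def by (intro CollectI exI[of _ "\<lambda>_. 0"]) (simp add: sum_fun_apply fun_eq_iff)
  have fL: "f v \<in> L" if "v \<in> L" for v
  proof -
    from that obtain z :: "'i \<Rightarrow> int" where "v = (\<Sum>s\<in>I. (\<lambda>x. of_int (z s) * e s x))"
      by (auto simp: L_def)
    then have fv: "f v = (\<Sum>s\<in>I. (\<lambda>x. of_int (z s) * f (e s) x))"
      by (simp add: f_sum f_scale)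
    have "(\<Sum>s\<in>S. (\<lambda>x. of_int (z s) * f (e s) x)) \<in> L" if "finite S" "S \<subseteq> I" for S
      using that
    proof (induction S)
      case empty
      show ?case using L0 by (simp only: sum.empty)
    next
      case (insert s S)
      have neg: "- u \<in> L" if "u \<in> L" for u using Ldiff[OF L0 that] by simp
      have add: "u + v \<in> L" if "u \<in> L" "v \<in> L" for u v
        using Ldiff[OF that(1) neg[OF that(2)]] by simp
      from insert.prems f_into[of s] obtain s' where s': "s' \<in> I" "f (e s) = e s'" by auto
      have "(\<Sum>s''\<in>I. (\<lambda>x. of_int (if s'' = s' then z s else 0) * e s'' x)) = (\<lambda>x. of_int (z s) * e s' x)"
        using I s'(1) by (simp add: sum_fun_apply fun_eq_iff if_distrib[where f = of_int] if_distribR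
            if_distrib[where f = "\<lambda>z. z * _"] cong: if_cong)
      then have "(\<lambda>x. of_int (z s) * e s' x) \<in> L"
        unfolding L_def by (intro CollectI exI[of _ "\<lambda>s''. if s'' = s' then z s else 0"]) simp
      moreover have "(\<Sum>s\<in>S. (\<lambda>x. of_int (z s) * f (e s) x)) \<in> L" using insert by simp
      ultimately show ?case
        by (subst sum.insert[OF insert.hyps], unfold s'(2), rule add)
    qed
    from this[OF I order_refl] show ?thesis unfolding fv .
  qed
  have "\<exists>B\<subseteq>L. finite B \<and> cfun.independent B \<and>
           (\<forall>v\<in>L. \<exists>z :: ('a \<Rightarrow> complex) \<Rightarrow> int. v = (\<Sum>b\<in>B. (\<lambda>x. of_int (z b) * b x)))"
  proof (rule int_lattice_basis[OF X L0 Ldiff])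
    show "v x \<in> \<int>" if "v \<in> L" for v x
      using that e_int by (auto simp: L_def sum_fun_apply intro!: Ints_sum Ints_mult)
    show "v x = 0" if "v \<in> L" "x \<notin> X" for v x
      using that e_supp by (auto simp: L_def sum_fun_apply)
  qed
  then obtain B where B: "B \<subseteq> L" "finite B" "cfun.independent B"
    and Bz: "\<And>v. v \<in> L \<Longrightarrow> \<exists>z :: ('a \<Rightarrow> complex) \<Rightarrow> int. v = (\<Sum>b\<in>B. (\<lambda>x. of_int (z b) * b x))"
    by blast
  have "L \<subseteq> V" unfolding L_def V_def
    by (auto intro!: cfun.span_sum cfun.span_scale intro: cfun.span_base)
  have spanB: "cfun.span B = V"
  proof
    show "cfun.span B \<subseteq> V"
      using B(1) \<open>L \<subseteq> V\<close> unfolding V_def by (metis cfun.span_mono cfun.span_span subset_trans)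
    have "L \<subseteq> cfun.span B"
    proof
      fix v assume "v \<in> L"
      from Bz[OF this] obtain z where "v = (\<Sum>b\<in>B. (\<lambda>x. of_int (z b) * b x))" by blast
      then show "v \<in> cfun.span B" by (auto intro!: cfun.span_sum cfun.span_scale intro: cfun.span_base)
    qed
    then have "e ` I \<subseteq> cfun.span B" using eL by auto
    then show "V \<subseteq> cfun.span B" unfolding V_def by (metis cfun.span_mono cfun.span_span)
  qed
  define B' where "B' = (SOME B. cfun.independent B \<and> cfun.span B = V)"
  have B': "cfun.independent B' \<and> cfun.span B' = V"
    unfolding B'_def by (rule someI[of _ B]) (use B spanB in auto)
  have tr: "cfun.trace_on V f = (\<Sum>b\<in>B'. cfun.representation B' (f b) b)"
    by (simp add: cfun.trace_on_def B'_def Let_def)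
  from key[of B'] B' tr
  show "c * cfun.trace_on (cfun.span (e ` I)) f = (\<Sum>s\<in>I. f (e s) (key s))"
    by (simp add: V_def)
  have "c * (\<Sum>b\<in>B. cfun.representation B (f b) b) = c * cfun.trace_on V f"
    using key[of B'] key[OF B(3) spanB] B' tr by simp
  then have "cfun.trace_on V f = (\<Sum>b\<in>B. cfun.representation B (f b) b)"
    using c by simp
  also have "\<dots> \<in> \<int>"
  proof (rule Ints_sum)
    fix b assume b: "b \<in> B"
    then have "f b \<in> L" using B(1) fL by auto
    from Bz[OF this] obtain z where z: "f b = (\<Sum>b\<in>B. (\<lambda>x. of_int (z b) * b x))" by blast
    show "cfun.representation B (f b) b \<in> \<int>"
      by (subst representation_combination[OF B(2,3) z b]) simp
  qed
  finally show "cfun.trace_on (cfun.span (e ` I)) f \<in> \<int>" by (simp add: V_def)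
qed

section \<open>Row and column permutations of a diagram\<close>

text \<open>
The equality case recognises an initial segment by its size and its sum.
\<close>

lemma sum_lessThan_card_le:
  fixes S :: "nat set"
  assumes "finite S"
  shows "\<Sum>{..<card S} \<le> \<Sum>S \<and> (\<Sum>S = \<Sum>{..<card S} \<longrightarrow> S = {..<card S})"
  using assms
proof (induction "card S" arbitrary: S)
  case 0
  then show ?case by simp
next
  case (Suc n)
  define m where "m = Max S"
  have ne: "S \<noteq> {}" using Suc.hyps(2) by auto
  have m: "m \<in> S" unfolding m_def using Suc.prems ne by (rule Max_in)
  have "S \<subseteq> {..m}" unfolding m_def using Suc.prems by auto
  then have "card S \<le> m + 1" using card_mono[of "{..m}" S] by simp
  then have nm: "n \<le> m" using Suc.hyps(2) by simp
  have card: "card (S - {m}) = n" using Suc.hyps(2) Suc.prems m by simp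
  have IH: "\<Sum>{..<n} \<le> \<Sum>(S - {m}) \<and> (\<Sum>(S - {m}) = \<Sum>{..<n} \<longrightarrow> S - {m} = {..<n})"
    using Suc.hyps(1)[of "S - {m}"] card Suc.prems by simp
  have sum: "\<Sum>S = m + \<Sum>(S - {m})" using sum.remove[OF Suc.prems m, of "\<lambda>x. x"] by simp
  have card': "card S = Suc n" using Suc.hyps(2) by simp
  show ?case unfolding card' lessThan_Suc
  proof (intro conjI impI)
    show "\<Sum>(insert n {..<n}) \<le> \<Sum>S" using IH nm sum by simp
    assume "\<Sum>S = \<Sum>(insert n {..<n})"
    then have "m = n" "\<Sum>(S - {m}) = \<Sum>{..<n}" using IH nm sum by simp_all
    then show "S = insert n {..<n}" using IH m by auto
  qed
qed

text \<open>
Young diagrams enter the theory of the Young symmetrizer only through this property: their columns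
are flush with the top row.
\<close>

locale column_diagram =
  fixes X :: "(nat \<times> nat) set"
  assumes finite_X: "finite X"
    and column_initial: "(i, j) \<in> X \<Longrightarrow> i' \<le> i \<Longrightarrow> (i', j) \<in> X"
begin

definition row_group :: "(nat \<times> nat \<Rightarrow> nat \<times> nat) set" where
  "row_group = {p. p permutes X \<and> fst \<circ> p = fst}"

definition col_group :: "(nat \<times> nat \<Rightarrow> nat \<times> nat) set" where
  "col_group = {q. q permutes X \<and> snd \<circ> q = snd}"

lemma row_groupD: "p \<in> row_group \<Longrightarrow> p permutes X" "p \<in> row_group \<Longrightarrow> fst (p x) = fst x"
  by (simp_all add: row_group_def) (metis comp_apply)

lemma col_groupD: "q \<in> col_group \<Longrightarrow> q permutes X" "q \<in> col_group \<Longrightarrow> snd (q x) = snd x"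
  by (simp_all add: col_group_def) (metis comp_apply)

lemma row_groupI: "p permutes X \<Longrightarrow> (\<And>x. fst (p x) = fst x) \<Longrightarrow> p \<in> row_group"
  by (simp add: row_group_def fun_eq_iff del: split_paired_All)

lemma col_groupI: "q permutes X \<Longrightarrow> (\<And>x. snd (q x) = snd x) \<Longrightarrow> q \<in> col_group"
  by (simp add: col_group_def fun_eq_iff del: split_paired_All)

lemma row_group_id: "id \<in> row_group"
  by (simp add: row_group_def)

lemma col_group_id: "id \<in> col_group"
  by (simp add: col_group_def)

lemma row_group_comp: "p \<in> row_group \<Longrightarrow> p' \<in> row_group \<Longrightarrow> p \<circ> p' \<in> row_group"
  by (intro row_groupI permutes_compose) (simp_all add: row_groupD)

lemma col_group_comp: "p \<in> col_group \<Longrightarrow> p' \<in> col_group \<Longrightarrow> p \<circ> p' \<in> col_group"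
  by (intro col_groupI permutes_compose) (simp_all add: col_groupD)

lemma row_group_inv:
  assumes p: "p \<in> row_group" shows "inv p \<in> row_group"
proof (rule row_groupI)
  show "fst (inv p x) = fst x" for x
    using row_groupD(2)[OF p, of "inv p x"] permutes_inverses(1)[OF row_groupD(1)[OF p]] by simp
qed (rule permutes_inv[OF row_groupD(1)[OF p]])

lemma col_group_inv:
  assumes q: "q \<in> col_group" shows "inv q \<in> col_group"
proof (rule col_groupI)
  show "snd (inv q x) = snd x" for x
    using col_groupD(2)[OF q, of "inv q x"] permutes_inverses(1)[OF col_groupD(1)[OF q]] by simp
qed (rule permutes_inv[OF col_groupD(1)[OF q]])

lemma finite_row_group: "finite row_group"
  by (rule finite_subset[OF _ finite_permutations[OF finite_X]]) (auto simp: row_group_def)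

lemma finite_col_group: "finite col_group"
  by (rule finite_subset[OF _ finite_permutations[OF finite_X]]) (auto simp: col_group_def)

lemma row_group_comp_iff:
  assumes "p \<in> row_group" shows "w \<circ> p \<in> row_group \<longleftrightarrow> w \<in> row_group"
proof
  assume "w \<circ> p \<in> row_group"
  from row_group_comp[OF this row_group_inv[OF assms]]
  show "w \<in> row_group"
    using permutes_inv_o(1)[OF row_groupD(1)[OF assms]] by (simp add: o_assoc[symmetric])
qed (rule row_group_comp[OF _ assms])

lemma row_group_iff:
  assumes w: "w permutes X"
  shows "w \<in> row_group \<longleftrightarrow> (\<forall>x\<in>X. fst (w x) = fst x)"
proof
  assume "\<forall>x\<in>X. fst (w x) = fst x"
  then have "fst (w x) = fst x" for x
    using permutes_not_in[OF w, of x] by (cases "x \<in> X") (simp_all del: split_paired_All)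
  then show "w \<in> row_group" by (rule row_groupI[OF w])
qed (simp add: row_groupD)

lemma col_row_group_trivial: "q \<in> col_group \<Longrightarrow> q \<in> row_group \<Longrightarrow> q = id"
  by (rule ext, rule prod_eqI) (simp_all add: col_groupD row_groupD)

lemma permutation_of: "p permutes X \<Longrightarrow> permutation p"
  using finite_X by (auto simp: permutation_permutes)

lemma sign_col_inv: "q \<in> col_group \<Longrightarrow> sign (inv q) = sign q"
  by (intro sign_inverse permutation_of col_groupD)

text \<open>
The coefficient of \<open>w\<close> in the Young symmetrizer, the sum of \<open>sgn q \<cdot> q p\<close> over column permutations \<open>q\<close>
and row permutations \<open>p\<close>. As the two groups meet trivially, at most one summand is nonzero.
\<close>

definition young_coeff :: "(nat \<times> nat \<Rightarrow> nat \<times> nat) \<Rightarrow> int" where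
  "young_coeff w = (\<Sum>q\<in>col_group. if inv q \<circ> w \<in> row_group then sign q else 0)"

lemma young_coeff_row: "p \<in> row_group \<Longrightarrow> young_coeff (w \<circ> p) = young_coeff w"
  by (simp add: young_coeff_def row_group_comp_iff o_assoc)

lemma sum_col_group_comp: 
  assumes "q0 \<in> col_group"
  shows "(\<Sum>q\<in>col_group. f q) = (\<Sum>q\<in>col_group. f (q0 \<circ> q))"
  by (rule sum.reindex_bij_witness[where i = "\<lambda>q. q0 \<circ> q" and j = "\<lambda>q. inv q0 \<circ> q"])
     (use assms col_group_comp col_group_inv[OF assms] permutes_inv_o[OF col_groupD(1)[OF assms]] in \<open>auto simp: o_assoc\<close>)

lemma sum_row_group_comp: 
  assumes "p0 \<in> row_group"
  shows "(\<Sum>p\<in>row_group. f p) = (\<Sum>p\<in>row_group. f (p \<circ> p0))"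
  by (rule sum.reindex_bij_witness[where i = "\<lambda>p. p \<circ> p0" and j = "\<lambda>p. p \<circ> inv p0"])
     (use assms row_group_comp row_group_inv[OF assms] permutes_inv_o[OF row_groupD(1)[OF assms]] in \<open>auto simp: o_assoc[symmetric]\<close>)

lemma young_coeff_col:
  assumes q0: "q0 \<in> col_group"
  shows "young_coeff (q0 \<circ> w) = sign q0 * young_coeff w"
proof -
  have "young_coeff (q0 \<circ> w) = (\<Sum>q\<in>col_group. if inv (q0 \<circ> q) \<circ> (q0 \<circ> w) \<in> row_group then sign (q0 \<circ> q) else 0)"
    unfolding young_coeff_def by (rule sum_col_group_comp[OF q0])
  also have "\<dots> = (\<Sum>q\<in>col_group. sign q0 * (if inv q \<circ> w \<in> row_group then sign q else 0))"
  proof (intro sum.cong refl)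
    fix q assume q: "q \<in> col_group"
    have "inv (q0 \<circ> q) \<circ> (q0 \<circ> w) = inv q \<circ> ((inv q0 \<circ> q0) \<circ> w)"
      using permutes_bij[OF col_groupD(1)[OF q]] permutes_bij[OF col_groupD(1)[OF q0]]
      by (simp add: o_inv_distrib o_assoc)
    also have "\<dots> = inv q \<circ> w" using permutes_inv_o(2)[OF col_groupD(1)[OF q0]] by simp
    finally show "(if inv (q0 \<circ> q) \<circ> (q0 \<circ> w) \<in> row_group then sign (q0 \<circ> q) else 0) =
        sign q0 * (if inv q \<circ> w \<in> row_group then sign q else 0)"
      using sign_compose[OF permutation_of[OF col_groupD(1)[OF q0]] permutation_of[OF col_groupD(1)[OF q]]]
      by simp
  qed
  finally show ?thesis by (simp add: young_coeff_def sum_distrib_left)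
qed

lemma young_coeff_id: "young_coeff id = 1"
proof -
  have "young_coeff id = (\<Sum>q\<in>col_group. if q = id then 1 else 0)"
    unfolding young_coeff_def
  proof (intro sum.cong refl)
    fix q assume q: "q \<in> col_group"
    have "inv q \<in> row_group \<longleftrightarrow> q = id"
    proof
      assume "inv q \<in> row_group"
      from row_group_inv[OF this] have "q \<in> row_group"
        using inv_inv_eq[OF permutes_bij[OF col_groupD(1)[OF q]]] by simp
      with q show "q = id" by (rule col_row_group_trivial)
    qed (simp add: row_group_id)
    then show "(if inv q \<circ> id \<in> row_group then sign q else 0) = (if q = id then 1 else 0)" by simp
  qed
  then show ?thesis using finite_col_group col_group_id by simp
qed

text \<open>
For each column \<open>j\<close>, the cells that \<open>w\<close> sends to column \<open>j\<close> lie in different rows. Let \<open>S j\<close> be the set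
of these rows; its size is the height of column \<open>j\<close>. Summed over all \<open>j\<close>, the sets \<open>S j\<close> and the columns
themselves both have total row number \<open>\<Sum>x\<in>X. fst x\<close>. Each column is an initial segment, hence has
the least possible sum for its size, so every \<open>S j\<close> must be that same initial segment. Therefore
the cell in the row of \<open>x\<close> and the column of \<open>w x\<close> belongs to the diagram, and moving \<open>x\<close> there is the
row permutation that is wanted.
\<close>

lemma col_row_factorisation:
  assumes w: "w permutes X"
    and spread: "\<And>x y. x \<in> X \<Longrightarrow> y \<in> X \<Longrightarrow> x \<noteq> y \<Longrightarrow> fst x = fst y \<Longrightarrow> snd (w x) \<noteq> snd (w y)"
  shows "\<exists>q\<in>col_group. inv q \<circ> w \<in> row_group"
proof -
  define D where "D j = {x \<in> X. snd (w x) = j}" for j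
  define E where "E j = {x \<in> X. snd x = j}" for j
  have finD: "finite (D j)" and finE: "finite (E j)" for j
    using finite_X by (auto simp: D_def E_def)
  have inj_D: "inj_on fst (D j)" for j
    using spread by (auto simp: inj_on_def D_def) blast
  have inj_E: "inj_on fst (E j)" for j
    by (auto simp: inj_on_def E_def)
  have "bij_betw w (D j) (E j)" for j
    unfolding bij_betw_def
  proof
    show "inj_on w (D j)" using permutes_inj[OF w] by (auto simp: inj_on_def)
    show "w ` D j = E j"
    proof
      show "w ` D j \<subseteq> E j" using w by (auto simp: D_def E_def permutes_in_image)
      show "E j \<subseteq> w ` D j"
      proof
        fix y assume "y \<in> E j"
        then have "inv w y \<in> D j"
          using w by (auto simp: D_def E_def permutes_inverses permutes_in_image[OF permutes_inv[OF w]])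
        then show "y \<in> w ` D j" using permutes_inverses(1)[OF w] by (metis imageI)
      qed
    qed
  qed
  then have card_eq: "card (D j) = card (E j)" for j by (rule bij_betw_same_card)
  have E_init: "fst ` E j = {..<card (E j)}" for j
  proof -
    define U where "U = fst ` E j"
    have U: "finite U" "card U = card (E j)"
      using finE card_image[OF inj_E] by (auto simp: U_def)
    have down: "a \<in> U" if "b \<in> U" "a \<le> b" for a b
      using that column_initial by (force simp: U_def E_def image_iff)
    have "U = {..<card U}"
    proof (cases "U = {}")
      case False
      then have "U = {..Max U}" using down U(1) Max_in by auto
      then show ?thesis by (metis card_atMost lessThan_Suc_atMost)
    qed simp
    then show ?thesis using U by (simp add: U_def)
  qed
  have D_init: "fst ` D j = {..<card (D j)}" for j
  proof -
    have le: "\<Sum>{..<card (D j)} \<le> \<Sum>(fst ` D j)"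
      and eq: "\<Sum>(fst ` D j) = \<Sum>{..<card (D j)} \<Longrightarrow> fst ` D j = {..<card (D j)}" for j
      using sum_lessThan_card_le[of "fst ` D j"] finD card_image[OF inj_D, of j] by auto
    have "X = (\<Union>j\<in>snd ` X. D j)"
    proof -
      have "snd (w x) \<in> snd ` X" if "x \<in> X" for x using that w by (auto simp: permutes_in_image)
      then show ?thesis by (auto simp: D_def)
    qed
    have "(\<Sum>j\<in>snd ` X. \<Sum>(fst ` D j)) = (\<Sum>j\<in>snd ` X. \<Sum>x\<in>D j. fst x)"
      by (simp add: sum.reindex[OF inj_D])
    also have "\<dots> = (\<Sum>x\<in>(\<Union>j\<in>snd ` X. D j). fst x)"
      by (rule sum.UNION_disjoint[symmetric]) (auto simp: finite_X finD, auto simp: D_def)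
    also have "(\<Union>j\<in>snd ` X. D j) = X" using \<open>X = _\<close> by simp
    also have "(\<Sum>x\<in>X. fst x) = (\<Sum>x\<in>(\<Union>j\<in>snd ` X. E j). fst x)"
      by (rule sum.cong) (auto simp: E_def)
    also have "\<dots> = (\<Sum>j\<in>snd ` X. \<Sum>x\<in>E j. fst x)"
      by (rule sum.UNION_disjoint) (auto simp: finite_X finE, auto simp: E_def)
    also have "\<dots> = (\<Sum>j\<in>snd ` X. \<Sum>(fst ` E j))"
      by (simp add: sum.reindex[OF inj_E])
    also have "\<dots> = (\<Sum>j\<in>snd ` X. \<Sum>{..<card (D j)})" by (simp add: E_init card_eq)
    \<comment> \<open>both sides are the total row number of the diagram, so each termwise inequality is an equality\<close>
    finally have total: "(\<Sum>j\<in>snd ` X. \<Sum>{..<card (D j)}) = (\<Sum>j\<in>snd ` X. \<Sum>(fst ` D j))" by simp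
    show ?thesis
    proof (cases "j \<in> snd ` X")
      case True
      show ?thesis
        by (rule eq, rule sym, rule sum_mono_inv[OF total le True]) (simp add: finite_X)
    next
      case False
      then have "E j = {}" by (force simp: E_def)
      then show ?thesis using card_eq[of j] finD[of j] by simp
    qed
  qed
  define p where "p x = (if x \<in> X then (fst x, snd (w x)) else x)" for x
  have pX: "p x \<in> X" if "x \<in> X" for x
  proof -
    have "fst x \<in> fst ` D (snd (w x))" using that by (auto simp: D_def)
    then have "fst x \<in> fst ` E (snd (w x))" by (simp add: D_init E_init card_eq)
    then show ?thesis using that by (auto simp: p_def E_def)
  qed
  have "inj_on p X" using spread by (auto simp: inj_on_def p_def)
  moreover from this have "p ` X = X" using pX finite_X
    by (metis card_image card_subset_eq image_subsetI)
  ultimately have p: "p permutes X"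
    by (intro bij_imp_permutes) (auto simp: bij_betw_def p_def)
  have pR: "p \<in> row_group" using p by (intro row_groupI) (auto simp: p_def)
  define q where "q = w \<circ> inv p"
  have q: "q permutes X" unfolding q_def by (intro permutes_compose permutes_inv p w)
  have "snd (q y) = snd y" for y
  proof (cases "y \<in> X")
    case True
    then have "inv p y \<in> X" using permutes_in_image[OF permutes_inv[OF p]] by simp
    then have "snd (w (inv p y)) = snd (p (inv p y))" by (simp add: p_def)
    then show ?thesis using permutes_inverses(1)[OF p] by (simp add: q_def)
  next
    case False
    then show ?thesis using q by (simp add: permutes_not_in)
  qed
  then have "q \<in> col_group" using q by (intro col_groupI)
  moreover have "inv q \<circ> w = p"
    using permutes_bij[OF p] permutes_bij[OF w] permutes_inv_o(2)[OF w] permutes_bij[OF permutes_inv[OF p]]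
    by (simp add: q_def o_inv_distrib inv_inv_eq o_assoc[symmetric])
  ultimately show ?thesis using pR by auto
qed

text \<open>
If \<open>w\<close> does not factor as a column permutation times a row permutation, then two cells of one row
are sent to the same column, and the transposition of their images shows \<open>\<phi> w = - \<phi> w\<close>.
\<close>

lemma col_alternating_row_invariant_unique:
  fixes \<phi> :: "(nat \<times> nat \<Rightarrow> nat \<times> nat) \<Rightarrow> int"
  assumes row: "\<And>w p. w permutes X \<Longrightarrow> p \<in> row_group \<Longrightarrow> \<phi> (w \<circ> p) = \<phi> w"
    and col: "\<And>w q. w permutes X \<Longrightarrow> q \<in> col_group \<Longrightarrow> \<phi> (q \<circ> w) = sign q * \<phi> w"
    and w: "w permutes X"
  shows "\<phi> w = \<phi> id * young_coeff w"
proof (cases "\<exists>q\<in>col_group. inv q \<circ> w \<in> row_group")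
  case True
  then obtain q where q: "q \<in> col_group" and p: "inv q \<circ> w \<in> row_group" by blast
  have w_eq: "w = q \<circ> (inv q \<circ> w)"
    using permutes_inv_o(1)[OF col_groupD(1)[OF q]] by (simp add: o_assoc)
  have "\<phi> w = sign q * \<phi> id"
    using col[OF row_groupD(1)[OF p] q] row[OF permutes_id p] w_eq by simp
  moreover have "young_coeff w = sign q"
    using young_coeff_col[OF q, of "inv q \<circ> w"] young_coeff_row[OF p, of id] w_eq young_coeff_id by simp
  ultimately show ?thesis by simp
next
  case False
  then obtain x y where xy: "x \<in> X" "y \<in> X" "x \<noteq> y" "fst x = fst y" "snd (w x) = snd (w y)"
    using col_row_factorisation[OF w] by blast
  define \<tau> where "\<tau> = transpose (w x) (w y)"
  have wne: "w x \<noteq> w y" using xy(3) permutes_inj[OF w] by (auto dest: injD)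
  have \<tau>: "\<tau> \<in> col_group"
    unfolding \<tau>_def using xy w
    by (intro col_groupI permutes_swap_id) (auto simp: permutes_in_image transpose_def)
  have \<sigma>: "transpose x y \<in> row_group"
    using xy by (intro row_groupI permutes_swap_id) (auto simp: transpose_def)
  have eq: "\<tau> \<circ> w = w \<circ> transpose x y"
    using permutes_inj[OF w] by (auto simp: \<tau>_def fun_eq_iff transpose_def dest: injD)
  have sgn: "sign \<tau> = -1" using wne by (simp add: \<tau>_def sign_swap_id)
  have "\<phi> w = - \<phi> w" using col[OF w \<tau>] row[OF w \<sigma>] eq sgn by simp
  moreover have "young_coeff w = - young_coeff w"
    using young_coeff_col[OF \<tau>, of w] young_coeff_row[OF \<sigma>, of w] eq sgn by simp
  ultimately show ?thesis by simp
qed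

text \<open>
The coefficient of the identity in the square of the Young symmetrizer.
\<close>

definition young_scalar :: int where
  "young_scalar = (\<Sum>v | v permutes X. young_coeff v * young_coeff (inv v))"

text \<open>
The square of the Young symmetrizer is again alternating under columns and invariant under rows,
hence a multiple of it.
\<close>

lemma young_coeff_convolution:
  assumes w: "w permutes X"
  shows "(\<Sum>v | v permutes X. young_coeff v * young_coeff (inv v \<circ> w)) = young_scalar * young_coeff w"
proof -
  define \<phi> where "\<phi> w = (\<Sum>v | v permutes X. young_coeff v * young_coeff (inv v \<circ> w))" for w
  have "\<phi> w = \<phi> id * young_coeff w"
  proof (rule col_alternating_row_invariant_unique[OF _ _ w])
    fix w p assume "p \<in> row_group"
    then show "\<phi> (w \<circ> p) = \<phi> w" by (simp add: \<phi>_def o_assoc young_coeff_row)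
  next
    fix w q assume q: "q \<in> col_group"
    have "\<phi> (q \<circ> w) = (\<Sum>v | v permutes X. young_coeff (q \<circ> v) * young_coeff (inv (q \<circ> v) \<circ> (q \<circ> w)))"
      unfolding \<phi>_def by (rule setum_permutations_compose_left[OF col_groupD(1)[OF q]])
    also have "\<dots> = (\<Sum>v | v permutes X. sign q * (young_coeff v * young_coeff (inv v \<circ> w)))"
    proof (intro sum.cong refl)
      fix v assume "v \<in> {v. v permutes X}"
      then have v: "v permutes X" by simp
      have "inv (q \<circ> v) \<circ> (q \<circ> w) = inv v \<circ> ((inv q \<circ> q) \<circ> w)"
        using permutes_bij[OF v] permutes_bij[OF col_groupD(1)[OF q]]
        by (simp add: o_inv_distrib o_assoc)
      also have "\<dots> = inv v \<circ> w" using permutes_inv_o(2)[OF col_groupD(1)[OF q]] by simp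
      finally show "young_coeff (q \<circ> v) * young_coeff (inv (q \<circ> v) \<circ> (q \<circ> w)) =
          sign q * (young_coeff v * young_coeff (inv v \<circ> w))"
        by (simp add: young_coeff_col[OF q])
    qed
    finally show "\<phi> (q \<circ> w) = sign q * \<phi> w" by (simp add: \<phi>_def sum_distrib_left)
  qed
  then show ?thesis by (simp add: \<phi>_def young_scalar_def)
qed

text \<open>
The coefficient of \<open>v\<close> in \<open>\<rho>\<kappa>\<rho>\<close>, where \<open>\<rho>\<close> sums the row permutations and \<open>\<kappa>\<close> is the signed sum of the
column permutations. Unlike those of \<open>\<kappa>\<rho>\<close>, these coefficients are symmetric under inversion.
\<close>

definition young_sum :: "(nat \<times> nat \<Rightarrow> nat \<times> nat) \<Rightarrow> int" where
  "young_sum v = (\<Sum>p\<in>row_group. young_coeff (p \<circ> v))"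

lemma young_sum_inv:
  assumes v: "v permutes X"
  shows "young_sum (inv v) = young_sum v"
proof -
  have expand: "young_sum u = (\<Sum>q\<in>col_group. \<Sum>p\<in>row_group. \<Sum>p'\<in>row_group. if p \<circ> u = q \<circ> p' then sign q else 0)"
    if u: "u permutes X" for u
  proof -
    have "(if inv q \<circ> (p \<circ> u) \<in> row_group then sign q else 0) =
        (\<Sum>p'\<in>row_group. if p \<circ> u = q \<circ> p' then sign q else 0)"
      if q: "q \<in> col_group" for p q
    proof -
      have "p \<circ> u = q \<circ> p' \<longleftrightarrow> p' = inv q \<circ> (p \<circ> u)" for p'
        using permutes_inv_o[OF col_groupD(1)[OF q]] by (metis comp_assoc id_comp)
      then show ?thesis using finite_row_group by simp
    qed
    then show ?thesis unfolding young_sum_def young_coeff_def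
      by (subst sum.swap) simp
  qed
  \<comment> \<open>inverting both sides exchanges p and p' and replaces q by its inverse, which has the same sign\<close>
  have flip: "p \<circ> inv v = q \<circ> p' \<longleftrightarrow> p' \<circ> v = inv q \<circ> p"
    if "q permutes X" "p permutes X" "p' permutes X" for p p' q
  proof
    assume "p \<circ> inv v = q \<circ> p'"
    then have "inv q \<circ> (p \<circ> inv v) \<circ> v = inv q \<circ> (q \<circ> p') \<circ> v" by simp
    then show "p' \<circ> v = inv q \<circ> p"
      using permutes_inv_o[OF that(1)] permutes_inv_o[OF v]
      by (metis comp_assoc comp_id id_comp)
  next
    assume "p' \<circ> v = inv q \<circ> p"
    then have "q \<circ> (p' \<circ> v) \<circ> inv v = q \<circ> (inv q \<circ> p) \<circ> inv v" by simp
    then show "p \<circ> inv v = q \<circ> p'"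
      using permutes_inv_o[OF that(1)] permutes_inv_o[OF v]
      by (metis comp_assoc comp_id id_comp)
  qed
  have "young_sum (inv v) = (\<Sum>q\<in>col_group. \<Sum>p\<in>row_group. \<Sum>p'\<in>row_group. if p \<circ> inv v = q \<circ> p' then sign q else 0)"
    by (rule expand[OF permutes_inv[OF v]])
  also have "\<dots> = (\<Sum>q\<in>col_group. \<Sum>p\<in>row_group. \<Sum>p'\<in>row_group. if p' \<circ> v = inv q \<circ> p then sign (inv q) else 0)"
    by (intro sum.cong refl) (simp add: flip col_groupD row_groupD sign_col_inv)
  also have "\<dots> = (\<Sum>q\<in>col_group. \<Sum>p'\<in>row_group. \<Sum>p\<in>row_group. if p' \<circ> v = inv q \<circ> p then sign (inv q) else 0)"
    by (intro sum.cong refl sum.swap)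
  also have "\<dots> = (\<Sum>q\<in>col_group. \<Sum>p'\<in>row_group. \<Sum>p\<in>row_group. if p' \<circ> v = q \<circ> p then sign q else 0)"
    by (rule sum.reindex_bij_witness[where i = inv and j = inv])
       (auto simp: col_group_inv inv_inv_eq permutes_bij[OF col_groupD(1)])
  also have "\<dots> = young_sum v" by (rule expand[OF v, symmetric])
  finally show ?thesis .
qed

text \<open>
Let \<open>\<tau>\<close> be the coefficient of the identity, which is a trace form on the group algebra. Then
\<open>|R|\<^sup>2 \<tau>(\<kappa>\<rho>\<kappa>\<rho>) = \<tau>((\<rho>\<kappa>\<rho>)\<^sup>2)\<close>, because \<open>\<rho>\<^sup>2 = |R| \<rho>\<close>, and the right-hand side is the sum of the squares of
the coefficients of \<open>\<rho>\<kappa>\<rho>\<close>, as these are symmetric under inversion. The coefficient at the identity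
is \<open>|R|\<close>.
\<close>

lemma young_scalar_pos: "young_scalar > 0"
proof -
  let ?P = "{v. v permutes X}" and ?r = "int (card row_group)"
  \<comment> \<open>substitute \<open>v \<circ> inv p\<close> for \<open>v\<close>; averaging over p then replaces the second factor by \<open>young_sum\<close>\<close>
  have shift: "young_scalar = (\<Sum>v\<in>?P. young_coeff v * young_coeff (p \<circ> inv v))" if p: "p \<in> row_group" for p
  proof -
    have "young_scalar = (\<Sum>v\<in>?P. young_coeff (v \<circ> inv p) * young_coeff (inv (v \<circ> inv p)))"
      unfolding young_scalar_def
      by (rule sum_permutations_compose_right[OF permutes_inv[OF row_groupD(1)[OF p]]])
    also have "\<dots> = (\<Sum>v\<in>?P. young_coeff v * young_coeff (p \<circ> inv v))"
    proof (intro sum.cong refl)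
      fix v assume "v \<in> ?P"
      then have "inv (v \<circ> inv p) = p \<circ> inv v"
        using permutes_bij[OF permutes_inv[OF row_groupD(1)[OF p]]] permutes_bij[OF row_groupD(1)[OF p]]
          permutes_bij[of v X] by (simp add: o_inv_distrib inv_inv_eq)
      then show "young_coeff (v \<circ> inv p) * young_coeff (inv (v \<circ> inv p)) = young_coeff v * young_coeff (p \<circ> inv v)"
        by (simp add: young_coeff_row[OF row_group_inv[OF p]])
    qed
    finally show ?thesis .
  qed
  have "?r * young_scalar = (\<Sum>p\<in>row_group. young_scalar)" by simp
  also have "\<dots> = (\<Sum>p\<in>row_group. \<Sum>v\<in>?P. young_coeff v * young_coeff (p \<circ> inv v))"
    by (intro sum.cong refl shift)
  also have "\<dots> = (\<Sum>v\<in>?P. young_coeff v * young_sum (inv v))"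
    by (subst sum.swap) (simp add: young_sum_def sum_distrib_left)
  also have "\<dots> = (\<Sum>v\<in>?P. young_coeff v * young_sum v)"
    by (simp add: young_sum_inv)
  finally have 1: "?r * young_scalar = (\<Sum>v\<in>?P. young_coeff v * young_sum v)" .
  \<comment> \<open>substitute \<open>p \<circ> v\<close> for \<open>v\<close>; averaging over p then replaces the first factor by \<open>young_sum\<close>\<close>
  have shift': "(\<Sum>v\<in>?P. young_coeff v * young_sum v) = (\<Sum>v\<in>?P. young_coeff (p \<circ> v) * young_sum v)"
    if p: "p \<in> row_group" for p
  proof -
    have "young_sum (p \<circ> v) = young_sum v" for v
      unfolding young_sum_def by (subst (2) sum_row_group_comp[OF p]) (simp add: o_assoc)
    then show ?thesis
      by (subst setum_permutations_compose_left[OF row_groupD(1)[OF p]]) simp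
  qed
  have "?r * (\<Sum>v\<in>?P. young_coeff v * young_sum v) = (\<Sum>p\<in>row_group. \<Sum>v\<in>?P. young_coeff v * young_sum v)"
    by simp
  also have "\<dots> = (\<Sum>p\<in>row_group. \<Sum>v\<in>?P. young_coeff (p \<circ> v) * young_sum v)"
    by (intro sum.cong refl shift')
  also have "\<dots> = (\<Sum>v\<in>?P. young_sum v * young_sum v)"
    by (subst sum.swap) (simp add: young_sum_def sum_distrib_right)
  finally have 2: "?r * (?r * young_scalar) = (\<Sum>v\<in>?P. young_sum v * young_sum v)" using 1 by simp
  have r: "?r > 0" using row_group_id finite_row_group by (auto simp: card_gt_0_iff)
  have "young_sum id = ?r"
    unfolding young_sum_def using young_coeff_row[of _ id] young_coeff_id by simp
  then have "0 < young_sum id * young_sum id" using r by simp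
  also have "\<dots> \<le> (\<Sum>v\<in>?P. young_sum v * young_sum v)"
    by (rule member_le_sum[of id ?P "\<lambda>v. young_sum v * young_sum v"])
       (simp_all add: finite_permutations finite_X)
  finally have "0 < ?r * (?r * young_scalar)" using 2 by simp
  then show ?thesis using r by (simp add: zero_less_mult_iff)
qed

text \<open>
Expanding both coefficients leaves, for each pair of column permutations, a number of permutations
of the cells. In this form the dependence on the shape can be controlled.
\<close>

lemma young_scalar_eq_count:
  "young_scalar = (\<Sum>q\<in>col_group. \<Sum>q'\<in>col_group. sign q * sign q' *
     int (card {v. v permutes X \<and> inv q \<circ> v \<in> row_group \<and> v \<circ> q' \<in> row_group}))"
proof -
  have "young_coeff v * young_coeff (inv v) = (\<Sum>q\<in>col_group. \<Sum>q'\<in>col_group.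
      if inv q \<circ> v \<in> row_group \<and> v \<circ> q' \<in> row_group then sign q * sign q' else 0)"
    if v: "v permutes X" for v
  proof -
    have "inv q' \<circ> inv v \<in> row_group \<longleftrightarrow> v \<circ> q' \<in> row_group" if q': "q' \<in> col_group" for q'
    proof -
      have "inv q' \<circ> inv v = inv (v \<circ> q')"
        using permutes_bij[OF v] permutes_bij[OF col_groupD(1)[OF q']] by (simp add: o_inv_distrib)
      moreover have "inv (inv (v \<circ> q')) = v \<circ> q'"
        by (intro inv_inv_eq permutes_bij[of _ X] permutes_compose col_groupD q' v)
      ultimately show ?thesis using row_group_inv by metis
    qed
    then show ?thesis unfolding young_coeff_def sum_product
      by (intro sum.cong refl) auto
  qed
  then have "young_scalar = (\<Sum>v | v permutes X. \<Sum>q\<in>col_group. \<Sum>q'\<in>col_group.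
      if inv q \<circ> v \<in> row_group \<and> v \<circ> q' \<in> row_group then sign q * sign q' else 0)"
    unfolding young_scalar_def by (intro sum.cong refl) simp
  also have "\<dots> = (\<Sum>q\<in>col_group. \<Sum>v | v permutes X. \<Sum>q'\<in>col_group.
      if inv q \<circ> v \<in> row_group \<and> v \<circ> q' \<in> row_group then sign q * sign q' else 0)"
    by (rule sum.swap)
  also have "\<dots> = (\<Sum>q\<in>col_group. \<Sum>q'\<in>col_group. \<Sum>v | v permutes X.
      if inv q \<circ> v \<in> row_group \<and> v \<circ> q' \<in> row_group then sign q * sign q' else 0)"
    by (intro sum.cong refl sum.swap)
  also have "\<dots> = (\<Sum>q\<in>col_group. \<Sum>q'\<in>col_group. sign q * sign q' *
     int (card {v. v permutes X \<and> inv q \<circ> v \<in> row_group \<and> v \<circ> q' \<in> row_group}))"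
  proof (intro sum.cong refl)
    fix q q'
    let ?P = "{v. inv q \<circ> v \<in> row_group \<and> v \<circ> q' \<in> row_group}"
    have "(\<Sum>v | v permutes X. if inv q \<circ> v \<in> row_group \<and> v \<circ> q' \<in> row_group then sign q * sign q' else 0) =
        (\<Sum>v | v permutes X. if v \<in> ?P then sign q * sign q' else 0)" by simp
    also have "\<dots> = (\<Sum>v\<in>{v. v permutes X} \<inter> ?P. sign q * sign q')"
      by (rule sum.inter_restrict[OF finite_permutations[OF finite_X], symmetric])
    also have "{v. v permutes X} \<inter> ?P = {v. v permutes X \<and> inv q \<circ> v \<in> row_group \<and> v \<circ> q' \<in> row_group}" by auto
    also have "(\<Sum>v\<in>{v. v permutes X \<and> inv q \<circ> v \<in> row_group \<and> v \<circ> q' \<in> row_group}. sign q * sign q') =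
      sign q * sign q' * int (card {v. v permutes X \<and> inv q \<circ> v \<in> row_group \<and> v \<circ> q' \<in> row_group})"
      unfolding sum_constant by (rule mult.commute)
    finally show "(\<Sum>v | v permutes X. if inv q \<circ> v \<in> row_group \<and> v \<circ> q' \<in> row_group then sign q * sign q' else 0) =
      sign q * sign q' * int (card {v. v permutes X \<and> inv q \<circ> v \<in> row_group \<and> v \<circ> q' \<in> row_group})" .
  qed
  finally show ?thesis .
qed

end

section \<open>Conjugacy in the symmetric group\<close>

lemma image_mset_eq_imp_bij_betw:
  assumes "finite A" "finite B" "image_mset f (mset_set A) = image_mset g (mset_set B)"
  shows "\<exists>F. bij_betw F A B \<and> (\<forall>a\<in>A. g (F a) = f a)"
  using assms
proof (induction A arbitrary: B)
  case empty
  then have "B = {}" by (simp add: mset_set_empty_iff)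
  then show ?case by (simp add: bij_betw_def)
next
  case (insert a A)
  have "f a \<in># image_mset g (mset_set B)"
    using insert.prems(2) insert.hyps by (simp flip: insert.prems(2))
  then obtain b where b: "b \<in> B" "g b = f a" using insert.prems(1) by auto
  have "mset_set B = add_mset b (mset_set (B - {b}))"
    using b(1) insert.prems(1) by (metis finite_Diff insert_Diff_single insert_absorb mset_set.insert_remove)
  then have "image_mset f (mset_set A) = image_mset g (mset_set (B - {b}))"
    using insert.prems(2) insert.hyps b(2) by simp
  from insert.IH[OF _ this] insert.prems(1) obtain F
    where F: "bij_betw F A (B - {b})" "\<forall>a\<in>A. g (F a) = f a" by auto
  have "bij_betw (F(a := b)) A (B - {b})"
    using F(1) insert.hyps by (subst bij_betw_cong[of _ _ F]) auto
  then have "bij_betw (F(a := b)) (insert a A) (insert b (B - {b}))"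
    using notIn_Un_bij_betw[of a A "F(a := b)" "B - {b}"] insert.hyps by auto
  then show ?case
    using F(2) b insert.hyps by (intro exI[of _ "F(a := b)"]) (auto simp: insert_absorb fun_upd_def)
qed

text \<open>
The least period of a point under a permutation is the size of its orbit.
\<close>

lemma funpow_eq_iff_mod_card_orbit:
  assumes "f permutes S" "finite S"
  shows "(f ^^ i) x = (f ^^ j) x \<longleftrightarrow> i mod card (orbit f x) = j mod card (orbit f x)"
proof -
  have perm: "permutation f" using assms by (auto simp: permutation_permutes)
  define n where "n = (LEAST n. 0 < n \<and> (f ^^ n) x = x)"
  have "\<exists>n. 0 < n \<and> (f ^^ n) x = x" using permutation_self[OF perm] by metis
  then have n: "0 < n \<and> (f ^^ n) x = x" unfolding n_def by (rule LeastI_ex)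
  have least: "(f ^^ k) x \<noteq> x" if "0 < k" "k < n" for k
    using not_less_Least[of k "\<lambda>n. 0 < n \<and> (f ^^ n) x = x"] that by (auto simp: n_def)
  have inj: "inj_on (\<lambda>k. (f ^^ k) x) {0..<n}"
    using n least by (intro inj_on_funpow_least) auto
  have "orbit f x = (\<lambda>k. (f ^^ k) x) ` {0..<n}"
    using orbit_altdef_bounded[of n f x] n by auto
  then have card: "card (orbit f x) = n" using card_image[OF inj] by simp
  have "(f ^^ i) x = (f ^^ j) x \<longleftrightarrow> (f ^^ (i mod n)) x = (f ^^ (j mod n)) x"
    using n by (simp add: funpow_mod_eq)
  also have "\<dots> \<longleftrightarrow> i mod n = j mod n"
    using inj_on_eq_iff[OF inj, of "i mod n" "j mod n"] n by auto
  finally show ?thesis using card by simp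
qed

text \<open>
Match the orbits of \<open>\<sigma>\<close> with orbits of \<open>\<tau>\<close> of the same size, choose a base point in every orbit, and
send the \<open>i\<close>-th iterate of a base point under \<open>\<sigma>\<close> to the \<open>i\<close>-th iterate of the matching base point
under \<open>\<tau>\<close>. This is well defined because both iterations have the same period.
\<close>

lemma same_orbit_sizes_conjugate:
  assumes \<sigma>: "\<sigma> permutes S" and \<tau>: "\<tau> permutes S" and fin: "finite S"
    and eq: "image_mset card (mset_set (orbit \<sigma> ` S)) = image_mset card (mset_set (orbit \<tau> ` S))"
  shows "\<exists>\<phi>. \<phi> permutes S \<and> (\<forall>x\<in>S. \<phi> (\<sigma> x) = \<tau> (\<phi> x))"
proof -
  have perm: "permutation \<sigma>" "permutation \<tau>"
    using \<sigma> \<tau> fin by (auto simp: permutation_permutes)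
  obtain F where F: "bij_betw F (orbit \<sigma> ` S) (orbit \<tau> ` S)"
    and F_card: "\<And>U. U \<in> orbit \<sigma> ` S \<Longrightarrow> card (F U) = card U"
    using image_mset_eq_imp_bij_betw[OF _ _ eq] fin by auto
  define base :: "'a set \<Rightarrow> 'a" where "base U = (SOME x. x \<in> U)" for U
  have base: "base (orbit f x) \<in> orbit f x" for f x
    unfolding base_def by (rule someI_ex) (use orbit_nonempty[of f x] in blast)
  have orbit_base: "orbit \<sigma> (base (orbit \<sigma> x)) = orbit \<sigma> x" "orbit \<tau> (base (orbit \<tau> x)) = orbit \<tau> x" for x
    using orbit_cyclic_eq3[OF cyclic_on_orbit'[OF perm(1)] base] orbit_cyclic_eq3[OF cyclic_on_orbit'[OF perm(2)] base]
    by blast+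
  define index where "index x = (SOME i. (\<sigma> ^^ i) (base (orbit \<sigma> x)) = x)" for x
  have index: "(\<sigma> ^^ index x) (base (orbit \<sigma> x)) = x" for x
  proof -
    have "x \<in> orbit \<sigma> (base (orbit \<sigma> x))"
      using permutation_self_in_orbit[OF perm(1)] orbit_base by blast
    then obtain i where "x = (\<sigma> ^^ i) (base (orbit \<sigma> x))"
      using orbit_altdef_permutation[OF perm(1), of "base (orbit \<sigma> x)"] by blast
    then have "\<exists>i. (\<sigma> ^^ i) (base (orbit \<sigma> x)) = x" by metis
    then show ?thesis unfolding index_def by (rule someI_ex)
  qed
  define \<psi> where "\<psi> x = (\<tau> ^^ index x) (base (F (orbit \<sigma> x)))" for x
  have F_orbit: "\<exists>y\<in>S. F (orbit \<sigma> x) = orbit \<tau> y" if "x \<in> S" for x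
    using bij_betwE[OF F] that by blast
  have card_orbits: "card (orbit \<tau> (base (F (orbit \<sigma> x)))) = card (orbit \<sigma> (base (orbit \<sigma> x)))" if "x \<in> S" for x
    using F_orbit[OF that] F_card[of "orbit \<sigma> x"] that by (auto simp: orbit_base)
  have \<psi>_eq: "\<psi> x = (\<tau> ^^ i) (base (F (orbit \<sigma> x)))" if "x \<in> S" "(\<sigma> ^^ i) (base (orbit \<sigma> x)) = x" for x i
  proof -
    have "(\<sigma> ^^ i) (base (orbit \<sigma> x)) = (\<sigma> ^^ index x) (base (orbit \<sigma> x))"
      using that(2) index by simp
    then have "i mod card (orbit \<sigma> (base (orbit \<sigma> x))) = index x mod card (orbit \<sigma> (base (orbit \<sigma> x)))"
      unfolding funpow_eq_iff_mod_card_orbit[OF \<sigma> fin] .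
    then have "(\<tau> ^^ i) (base (F (orbit \<sigma> x))) = (\<tau> ^^ index x) (base (F (orbit \<sigma> x)))"
      unfolding funpow_eq_iff_mod_card_orbit[OF \<tau> fin] card_orbits[OF that(1)] .
    then show ?thesis by (simp add: \<psi>_def)
  qed
  have step: "\<psi> (\<sigma> x) = \<tau> (\<psi> x)" if "x \<in> S" for x
  proof -
    have o: "orbit \<sigma> (\<sigma> x) = orbit \<sigma> x" by (rule permutation_orbit_step[OF perm(1)])
    have "(\<sigma> ^^ Suc (index x)) (base (orbit \<sigma> (\<sigma> x))) = \<sigma> x"
      using index[of x] o by simp
    from \<psi>_eq[OF _ this] show ?thesis
      using that \<sigma> o by (simp add: permutes_in_image \<psi>_def)
  qed
  have surj: "S \<subseteq> \<psi> ` S"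
  proof
    fix y assume y: "y \<in> S"
    then have "orbit \<tau> y \<in> F ` orbit \<sigma> ` S" using F by (auto simp: bij_betw_def)
    then obtain x where x: "x \<in> S" "F (orbit \<sigma> x) = orbit \<tau> y" by auto
    have "y \<in> orbit \<tau> (base (orbit \<tau> y))"
      using permutation_self_in_orbit[OF perm(2)] orbit_base by blast
    then obtain i where i: "y = (\<tau> ^^ i) (base (orbit \<tau> y))"
      using orbit_altdef_permutation[OF perm(2), of "base (orbit \<tau> y)"] by blast
    have "(\<sigma> ^^ i) (base (orbit \<sigma> x)) \<in> orbit \<sigma> x" by (rule funpow_in_orbit[OF base])
    then obtain z where z: "z = (\<sigma> ^^ i) (base (orbit \<sigma> x))" and z_orb: "z \<in> orbit \<sigma> x" by blast
    have zS: "z \<in> S" using permutes_orbit_subset[OF \<sigma> x(1)] z_orb by (rule subsetD)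
    have oz: "orbit \<sigma> z = orbit \<sigma> x"
      by (rule orbit_cyclic_eq3[OF cyclic_on_orbit'[OF perm(1)] z_orb])
    have "(\<sigma> ^^ i) (base (orbit \<sigma> z)) = z" unfolding oz by (rule z[symmetric])
    from \<psi>_eq[OF zS this] have "\<psi> z = (\<tau> ^^ i) (base (orbit \<tau> y))" unfolding oz x(2) .
    from trans[OF this i[symmetric]] have "\<psi> z = y" .
    then show "y \<in> \<psi> ` S" using zS by (intro image_eqI[of y \<psi> z]) simp_all
  qed
  have into: "\<psi> ` S = S"
    by (rule sym, rule card_seteq[OF _ surj]) (use fin in \<open>auto intro: card_image_le\<close>)
  define \<phi> where "\<phi> x = (if x \<in> S then \<psi> x else x)" for x
  have "\<phi> ` S = S" using into by (auto simp: \<phi>_def)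
  then have "bij_betw \<phi> S S" using fin by (simp add: bij_betw_def eq_card_imp_inj_on)
  then have "\<phi> permutes S" by (rule bij_imp_permutes) (simp add: \<phi>_def)
  moreover have "\<phi> (\<sigma> x) = \<tau> (\<phi> x)" if "x \<in> S" for x
    using that step[OF that] \<sigma> by (simp add: \<phi>_def permutes_in_image)
  ultimately show ?thesis by blast
qed

lemma cycle_type_append_fixpoints:
  assumes g: "g permutes {1..m}"
  shows "cycle_type (m + d) g = cycle_type m g + replicate_mset d 1"
proof (induction d)
  case (Suc d)
  have fixed: "g (Suc (m + d)) = Suc (m + d)" using g by (intro permutes_not_in) auto
  then have o: "orbit g (Suc (m + d)) = {Suc (m + d)}" using fixed by (simp add: orbit_eq_singleton_iff)
  have gd: "g permutes {1..m + d}" by (rule permutes_subset[OF g]) auto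
  have notin: "{Suc (m + d)} \<notin> orbit g ` {1..m + d}"
  proof
    assume "{Suc (m + d)} \<in> orbit g ` {1..m + d}"
    then obtain x where "x \<in> {1..m + d}" and x: "{Suc (m + d)} = orbit g x" by blast
    from permutes_orbit_subset[OF gd this(1)] have "{Suc (m + d)} \<subseteq> {1..m + d}" unfolding x .
    then show False by simp
  qed
  have "{1..m + Suc d} = insert (Suc (m + d)) {1..m + d}" by auto
  then have "orbit g ` {1..m + Suc d} = insert {Suc (m + d)} (orbit g ` {1..m + d})" using o by simp
  then show ?case using notin Suc by (simp add: cycle_type_def)
qed simp

lemma cycle_type_append_cycle:
  assumes g: "g permutes {1..m}" and a: "a > 0"
  shows "\<exists>h. h permutes {1..m + a} \<and> cycle_type (m + a) h = add_mset a (cycle_type m g)"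
proof -
  \<comment> \<open>\<open>h\<close> is \<open>g\<close> together with the cycle \<open>m + 1, \<dots>, m + a\<close>\<close>
  define h where "h x = (if x \<in> {m + 1..<m + a} then Suc x else if x = m + a then m + 1 else g x)" for x
  have img: "g ` {1..m} = {1..m}" using permutes_image[OF g] .
  have "{1..m + a} \<subseteq> h ` {1..m + a}"
  proof
    fix y assume y: "y \<in> {1..m + a}"
    consider "y \<le> m" | "y = m + 1" | "y \<in> {m + 2..m + a}" using y by force
    then show "y \<in> h ` {1..m + a}"
    proof cases
      case 1
      then obtain x where x: "x \<in> {1..m}" "g x = y" using y img by (metis atLeastAtMost_iff imageE)
      then have "h x = y" using a by (auto simp: h_def)
      then show ?thesis using x by force
    next
      case 2
      then show ?thesis using a by (intro image_eqI[of _ _ "m + a"]) (auto simp: h_def)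
    next
      case 3
      then show ?thesis by (intro image_eqI[of _ _ "y - 1"]) (auto simp: h_def)
    qed
  qed
  then have "h ` {1..m + a} = {1..m + a}"
    by (metis card_image_le card_seteq finite_atLeastAtMost finite_imageI)
  then have "bij_betw h {1..m + a} {1..m + a}" by (simp add: bij_betw_def eq_card_imp_inj_on)
  then have h: "h permutes {1..m + a}"
    by (rule bij_imp_permutes) (use g a in \<open>auto simp: h_def intro: permutes_not_in\<close>)
  have old: "orbit h x = orbit g x" if "x \<in> {1..m}" for x
  proof (rule orbit_cong0[OF that])
    have "g y \<in> {1..m}" if "y \<in> {1..m}" for y using permutes_in_image[OF g] that by blast
    then show "h \<in> {1..m} \<rightarrow> {1..m}" using a by (auto simp: h_def)
    show "h y = g y" if "y \<in> {1..m}" for y using a that by (auto simp: h_def)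
  qed
  have up: "m + 1 + i \<in> orbit h (m + 1)" if "i < a" for i
    using that
  proof (induction i)
    case 0
    show ?case using permutation_self_in_orbit[of h "m + 1"] h by (auto simp: permutation_permutes)
  next
    case (Suc i)
    then have "m + 1 + i \<in> orbit h (m + 1)" by simp
    then have "h (m + 1 + i) \<in> orbit h (m + 1)" by (rule orbit.step)
    moreover have "h (m + 1 + i) = m + 1 + Suc i" using Suc.prems by (simp add: h_def)
    ultimately show ?case by (simp only:)
  qed
  have "orbit h (m + 1) = {m + 1..m + a}"
  proof
    show "orbit h (m + 1) \<subseteq> {m + 1..m + a}"
    proof
      fix y assume "y \<in> orbit h (m + 1)"
      then show "y \<in> {m + 1..m + a}" by induct (use a in \<open>auto simp: h_def\<close>)
    qed
    show "{m + 1..m + a} \<subseteq> orbit h (m + 1)"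
    proof
      fix y assume "y \<in> {m + 1..m + a}"
      then show "y \<in> orbit h (m + 1)" using up[of "y - (m + 1)"] by auto
    qed
  qed
  moreover have "cyclic_on h (orbit h (m + 1))" by (rule cyclic_on_orbit[OF h]) simp
  ultimately have new: "orbit h x = {m + 1..m + a}" if "x \<in> {m + 1..m + a}" for x
    using orbit_cyclic_eq3 that by metis
  have "{1..m + a} = {1..m} \<union> {m + 1..m + a}" by auto
  then have "orbit h ` {1..m + a} = orbit h ` {1..m} \<union> orbit h ` {m + 1..m + a}" by (simp only: image_Un)
  also have "orbit h ` {1..m} = orbit g ` {1..m}" by (rule image_cong) (auto simp: old)
  also have "orbit h ` {m + 1..m + a} = {{m + 1..m + a}}" using new a by force
  finally have orbits: "orbit h ` {1..m + a} = insert {m + 1..m + a} (orbit g ` {1..m})" by simp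
  have "{m + 1..m + a} \<notin> orbit g ` {1..m}"
  proof
    assume "{m + 1..m + a} \<in> orbit g ` {1..m}"
    then obtain x where "x \<in> {1..m}" "{m + 1..m + a} = orbit g x" by blast
    with permutes_orbit_subset[OF g, of x] a show False by force
  qed
  then have "cycle_type (m + a) h = add_mset a (cycle_type m g)"
    unfolding cycle_type_def orbits by simp
  with h show ?thesis by blast
qed

lemma ex_permutation_cycle_type:
  assumes "0 \<notin> set \<nu>"
  shows "\<exists>g. g permutes {1..sum_list \<nu>} \<and> cycle_type (sum_list \<nu>) g = mset \<nu>"
  using assms
proof (induction \<nu>)
  case Nil
  then show ?case by (intro exI[of _ id]) (simp add: cycle_type_def fun_eq_iff)
next
  case (Cons a \<nu>)
  then obtain g where g: "g permutes {1..sum_list \<nu>}" "cycle_type (sum_list \<nu>) g = mset \<nu>" by auto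
  have "a > 0" using Cons.prems by (cases a) auto
  from cycle_type_append_cycle[OF g(1) this] obtain h where
    h: "h permutes {1..sum_list \<nu> + a}" "cycle_type (sum_list \<nu> + a) h = add_mset a (cycle_type (sum_list \<nu>) g)"
    by blast
  have sum: "sum_list (a # \<nu>) = sum_list \<nu> + a" by simp
  from h g(2) show ?case unfolding sum mset.simps by (intro exI[of _ h]) simp
qed

section \<open>Counting bijections with a prescribed finite part\<close>

text \<open>
Bijections are normalised outside \<open>X\<close> by a default function \<open>d\<close>, so that they can be counted. The
default 0 serves for tableaux, and the identity turns permutations into a special case.
\<close>

definition bijs :: "('a \<Rightarrow> 'b) \<Rightarrow> 'a set \<Rightarrow> 'b set \<Rightarrow> ('a \<Rightarrow> 'b) set" where
  "bijs d X Y = {t. bij_betw t X Y \<and> (\<forall>x. x \<notin> X \<longrightarrow> t x = d x)}"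

lemma card_bijs_fixed_value:
  assumes "x \<in> X" "a \<notin> Y"
  shows "card {t \<in> bijs d X (insert a Y). t x = a \<and> P t} = card {s \<in> bijs d (X - {x}) Y. P (s(x := a))}"
proof (rule bij_betw_same_card)
  show "bij_betw (\<lambda>t. t(x := d x)) {t \<in> bijs d X (insert a Y). t x = a \<and> P t}
          {s \<in> bijs d (X - {x}) Y. P (s(x := a))}"
  proof (rule bij_betw_byWitness[where f' = "\<lambda>s. s(x := a)"])
    show "\<forall>t\<in>{t \<in> bijs d X (insert a Y). t x = a \<and> P t}. (t(x := d x))(x := a) = t"
      by auto
    show "\<forall>s\<in>{s \<in> bijs d (X - {x}) Y. P (s(x := a))}. (s(x := a))(x := d x) = s"
      by (auto simp: bijs_def fun_upd_idem_iff)
    show "(\<lambda>t. t(x := d x)) ` {t \<in> bijs d X (insert a Y). t x = a \<and> P t} \<subseteq>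
            {s \<in> bijs d (X - {x}) Y. P (s(x := a))}"
    proof (intro image_subsetI)
      fix t assume "t \<in> {t \<in> bijs d X (insert a Y). t x = a \<and> P t}"
      then have t: "bij_betw t X (insert a Y)" "\<forall>x. x \<notin> X \<longrightarrow> t x = d x" "t x = a" "P t"
        by (auto simp: bijs_def)
      have "bij_betw t (X - {x}) (insert a Y - {a})"
        using bij_betw_DiffI[OF t(1), of "{x}" "{a}"] assms t(3) by (auto simp: bij_betw_def)
      then have "bij_betw (t(x := d x)) (X - {x}) Y"
        using assms(2) by (subst bij_betw_cong[of _ _ t]) auto
      moreover have "(t(x := d x))(x := a) = t" using t(3) by auto
      ultimately show "t(x := d x) \<in> {s \<in> bijs d (X - {x}) Y. P (s(x := a))}"
        using t by (auto simp: bijs_def)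
    qed
    show "(\<lambda>s. s(x := a)) ` {s \<in> bijs d (X - {x}) Y. P (s(x := a))} \<subseteq>
            {t \<in> bijs d X (insert a Y). t x = a \<and> P t}"
    proof (intro image_subsetI)
      fix s assume "s \<in> {s \<in> bijs d (X - {x}) Y. P (s(x := a))}"
      then have s: "bij_betw s (X - {x}) Y" "\<forall>z. z \<notin> X - {x} \<longrightarrow> s z = d z" "P (s(x := a))"
        by (auto simp: bijs_def)
      have "bij_betw (s(x := a)) (X - {x}) Y"
        using s(1) by (subst bij_betw_cong[of _ _ s]) auto
      then have "bij_betw (s(x := a)) (insert x (X - {x})) (insert a Y)"
        using notIn_Un_bij_betw[of x "X - {x}" "s(x := a)" Y] assms by auto
      then have "bij_betw (s(x := a)) X (insert a Y)"
        using assms(1) by (simp add: insert_absorb)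
      then show "s(x := a) \<in> {t \<in> bijs d X (insert a Y). t x = a \<and> P t}"
        using s assms(1) by (auto simp: bijs_def)
    qed
  qed
qed


lemma bijs_preimage:
  assumes "t \<in> bijs d X Y" "a \<in> Y" obtains x where "x \<in> X" "t x = a"
  using assms by (auto simp: bijs_def bij_betw_def)

lemma bijs_in: "t \<in> bijs d X Y \<Longrightarrow> x \<in> X \<Longrightarrow> t x \<in> Y"
  by (auto simp: bijs_def bij_betw_def)

lemma bijs_inj: "t \<in> bijs d X Y \<Longrightarrow> x \<in> X \<Longrightarrow> y \<in> X \<Longrightarrow> t x = t y \<Longrightarrow> x = y"
  by (auto simp: bijs_def bij_betw_def inj_on_def)

lemma bijs_fibres_disjoint:
  "x \<in> X \<Longrightarrow> y \<in> X \<Longrightarrow> x \<noteq> y \<Longrightarrow>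
     {t \<in> bijs d X Y. t x = a \<and> P t} \<inter> {t \<in> bijs d X Y. t y = a \<and> P t} = {}"
  by (auto simp: bijs_def bij_betw_def inj_on_def)

lemma finite_bijs:
  assumes "finite X" "finite Y"
  shows "finite (bijs d X Y)"
proof -
  have "inj_on (\<lambda>t. restrict t X) (bijs d X Y)"
  proof (rule inj_onI)
    fix s t assume "s \<in> bijs d X Y" "t \<in> bijs d X Y" and eq: "restrict s X = restrict t X"
    then have "\<forall>x. x \<notin> X \<longrightarrow> s x = t x" by (simp add: bijs_def)
    moreover have "s x = t x" if "x \<in> X" for x using fun_cong[OF eq, of x] that by simp
    ultimately show "s = t" by blast
  qed
  moreover have "finite ((\<lambda>t. restrict t X) ` bijs d X Y)"
    by (rule finite_subset[OF _ finite_PiE[OF assms(1), of "\<lambda>_. Y"]])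
       (use assms bijs_in in \<open>auto simp: PiE_def\<close>)
  ultimately show ?thesis by (rule finite_imageD[rotated])
qed

lemma card_bijs:
  assumes "finite X" "finite Y" "card X = card Y"
  shows "card (bijs d X Y) = fact (card Y)"
  using assms(2,1,3)
proof (induction Y arbitrary: X)
  case empty
  then have "bijs d X {} = {d}" by (auto simp: bijs_def bij_betw_def)
  then show ?case by simp
next
  case (insert a Y)
  have "bijs d X (insert a Y) = (\<Union>x\<in>X. {t \<in> bijs d X (insert a Y). t x = a \<and> True})"
    using bijs_preimage[of _ d X "insert a Y" a] by blast
  also have "card \<dots> = (\<Sum>x\<in>X. card {t \<in> bijs d X (insert a Y). t x = a \<and> True})"
    using insert.prems insert.hyps
    by (intro card_UN_disjoint ballI impI bijs_fibres_disjoint) (auto intro!: finite_bijs)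
  also have "\<dots> = (\<Sum>x\<in>X. card {s \<in> bijs d (X - {x}) Y. True})"
    using insert.hyps by (intro sum.cong refl card_bijs_fixed_value) auto
  also have "\<dots> = (\<Sum>x\<in>X. fact (card Y))"
    using insert by (intro sum.cong refl) simp
  finally show ?case using insert by simp
qed

text \<open>
Truncated subtraction is harmless here: for \<open>j > b\<close> one of the factors is 0.
\<close>

definition falling :: "nat \<Rightarrow> nat \<Rightarrow> nat" where
  "falling b j = (\<Prod>i<j. b - i)"

lemma falling_Suc: "falling b (Suc j) = b * falling (b - 1) j"
  by (simp add: falling_def prod.lessThan_Suc_shift del: prod.lessThan_Suc)

lemma of_nat_falling: "of_nat (falling b j) = poly (\<Prod>i<j. [:- of_nat i, 1:]) (of_nat b :: rat)"
proof (cases "j \<le> b")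
  case True
  then show ?thesis unfolding falling_def of_nat_prod poly_prod
    by (intro prod.cong refl) (simp add: of_nat_diff)
next
  case False
  then have "falling b j = 0" by (auto simp: falling_def intro!: bexI[of _ b])
  moreover have "poly (\<Prod>i<j. [:- of_nat i, 1:]) (of_nat b :: rat) = 0"
    using False by (auto simp: poly_prod intro!: bexI[of _ b])
  ultimately show ?thesis by simp
qed

definition overlap :: "'a set \<Rightarrow> 'b set \<Rightarrow> ('a \<Rightarrow> 'b) \<Rightarrow> ('a \<times> 'b) set" where
  "overlap A A' t = {(x, t x) | x. x \<in> A \<and> t x \<in> A'}"

text \<open>
Build the bijection by choosing the preimages of the elements of \<open>A'\<close> one after another. An element
in the range of \<open>r\<close> has its preimage prescribed. Any other element needs a preimage in \<open>B\<close> that has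
not been used, which contributes the falling factorial. When \<open>A'\<close> is exhausted, the remaining
elements are matched with \<open>B'\<close> in an arbitrary way.
\<close>

lemma card_bijs_overlap:
  assumes "finite A'" "finite A" "finite B" "finite B'" "A \<inter> B = {}" "A' \<inter> B' = {}"
    and "card A + card B = card A' + card B'"
    and "r \<subseteq> A \<times> A'" "single_valued r" "single_valued (r\<inverse>)"
  shows "card {t \<in> bijs d (A \<union> B) (A' \<union> B'). overlap A A' t = r} = fact (card B') * falling (card B) (card A' - card r)"
  using assms
proof (induction A' arbitrary: A B r)
  case empty
  then have "{t \<in> bijs d (A \<union> B) ({} \<union> B'). overlap A {} t = r} = bijs d (A \<union> B) B'"
    by (auto simp: overlap_def)
  then show ?case using empty by (simp add: card_bijs card_Un_disjoint falling_def)
next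
  case (insert a A')
  have aB': "a \<notin> B'" using insert.prems by auto
  have fin_r: "finite r" using insert.prems(1,7) insert.hyps by (meson finite_SigmaI finite_insert finite_subset)
  show ?case
  proof (cases "\<exists>x. (x, a) \<in> r")
    case True
    then obtain x where x: "(x, a) \<in> r" by blast
    then have xA: "x \<in> A" using insert.prems by auto
    have x_only: "b = a" if "(x, b) \<in> r" for b using insert.prems(8) x that by (auto simp: single_valued_def)
    have a_only: "y = x" if "(y, a) \<in> r" for y using insert.prems(9) x that by (auto simp: single_valued_def)
    have "{t \<in> bijs d (A \<union> B) (insert a A' \<union> B'). overlap A (insert a A') t = r}
        = {t \<in> bijs d (A \<union> B) (insert a (A' \<union> B')). t x = a \<and> overlap A (insert a A') t = r}"
      using x by (auto simp: overlap_def)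
    also have "card \<dots> = card {s \<in> bijs d (A \<union> B - {x}) (A' \<union> B'). overlap A (insert a A') (s(x := a)) = r}"
      by (rule card_bijs_fixed_value) (use xA aB' insert.hyps in auto)
    also have "A \<union> B - {x} = (A - {x}) \<union> B" using insert.prems xA by auto
    also have "{s \<in> bijs d ((A - {x}) \<union> B) (A' \<union> B'). overlap A (insert a A') (s(x := a)) = r} =
        {s \<in> bijs d ((A - {x}) \<union> B) (A' \<union> B'). overlap (A - {x}) A' s = r - {(x, a)}}"
    proof (intro Collect_cong conj_cong refl)
      fix s assume s: "s \<in> bijs d ((A - {x}) \<union> B) (A' \<union> B')"
      have "s y \<noteq> a" if "y \<in> A - {x}" for y
        using bijs_in[OF s, of y] that aB' insert.hyps by auto
      then have "overlap A (insert a A') (s(x := a)) = insert (x, a) (overlap (A - {x}) A' s)"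
        using xA by (auto simp: overlap_def)
      moreover have "(x, a) \<notin> overlap (A - {x}) A' s" by (auto simp: overlap_def)
      ultimately show "overlap A (insert a A') (s(x := a)) = r \<longleftrightarrow> overlap (A - {x}) A' s = r - {(x, a)}"
        using x by auto
    qed
    also have "card \<dots> = fact (card B') * falling (card B) (card A' - card (r - {(x, a)}))"
    proof (rule insert.IH)
      show "r - {(x, a)} \<subseteq> (A - {x}) \<times> A'" using insert.prems(7) x_only a_only by auto
      show "card (A - {x}) + card B = card A' + card B'"
        using insert.prems(1,6) insert.hyps xA card_Suc_Diff1[of A x] by simp
      show "single_valued (r - {(x, a)})" "single_valued ((r - {(x, a)})\<inverse>)"
        using insert.prems(8,9) by (auto simp: single_valued_def)
    qed (use insert.prems in auto)
    also have "card A' - card (r - {(x, a)}) = card (insert a A') - card r"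
      using insert.hyps x fin_r card_Suc_Diff1[OF fin_r x] by simp
    finally show ?thesis .
  next
    case False
    then have r': "r \<subseteq> A \<times> A'" using insert.prems(7) by auto
    have "card r \<le> card A'"
    proof (rule card_inj_on_le)
      show "inj_on snd r" using insert.prems(9) by (auto simp: inj_on_def single_valued_def)
    qed (use r' insert.hyps in auto)
    then have num: "card (insert a A') - card r = Suc (card A' - card r)"
      using insert.hyps by simp
    have "{t \<in> bijs d (A \<union> B) (insert a A' \<union> B'). overlap A (insert a A') t = r}
        = (\<Union>z\<in>B. {t \<in> bijs d (A \<union> B) (insert a (A' \<union> B')). t z = a \<and> overlap A (insert a A') t = r})"
    proof (intro equalityI subsetI)
      fix t assume t: "t \<in> {t \<in> bijs d (A \<union> B) (insert a A' \<union> B'). overlap A (insert a A') t = r}"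
      then obtain z where z: "z \<in> A \<union> B" "t z = a"
        using bijs_preimage[of t d "A \<union> B" "insert a A' \<union> B'" a] by blast
      with t False have "z \<notin> A" by (auto simp: overlap_def)
      with z t show "t \<in> (\<Union>z\<in>B. {t \<in> bijs d (A \<union> B) (insert a (A' \<union> B')). t z = a \<and> overlap A (insert a A') t = r})"
        by auto
    qed auto
    also have "card \<dots> = (\<Sum>z\<in>B. card {t \<in> bijs d (A \<union> B) (insert a (A' \<union> B')). t z = a \<and> overlap A (insert a A') t = r})"
      using insert.prems insert.hyps
      by (intro card_UN_disjoint ballI impI bijs_fibres_disjoint) (auto intro!: finite_bijs)
    also have "\<dots> = (\<Sum>z\<in>B. fact (card B') * falling (card B - 1) (card A' - card r))"
    proof (intro sum.cong refl)
      fix z assume z: "z \<in> B"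
      have "card {t \<in> bijs d (A \<union> B) (insert a (A' \<union> B')). t z = a \<and> overlap A (insert a A') t = r} =
          card {s \<in> bijs d (A \<union> B - {z}) (A' \<union> B'). overlap A (insert a A') (s(z := a)) = r}"
        by (rule card_bijs_fixed_value) (use z aB' insert.hyps in auto)
      also have "A \<union> B - {z} = A \<union> (B - {z})" using insert.prems z by auto
      also have "{s \<in> bijs d (A \<union> (B - {z})) (A' \<union> B'). overlap A (insert a A') (s(z := a)) = r} =
          {s \<in> bijs d (A \<union> (B - {z})) (A' \<union> B'). overlap A A' s = r}"
      proof (intro Collect_cong conj_cong refl)
        fix s assume s: "s \<in> bijs d (A \<union> (B - {z})) (A' \<union> B')"
        have "s y \<noteq> a \<and> y \<noteq> z" if "y \<in> A" for y
          using bijs_in[OF s, of y] that aB' insert.hyps insert.prems(4) z by auto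
        then have "overlap A (insert a A') (s(z := a)) = overlap A A' s"
          by (auto simp: overlap_def)
        then show "overlap A (insert a A') (s(z := a)) = r \<longleftrightarrow> overlap A A' s = r" by simp
      qed
      also have "card \<dots> = fact (card B') * falling (card (B - {z})) (card A' - card r)"
      proof (rule insert.IH)
        show "card A + card (B - {z}) = card A' + card B'"
          using insert.prems(2,6) insert.hyps z card_Suc_Diff1[of B z] by simp
      qed (use insert.prems r' in auto)
      finally show "card {t \<in> bijs d (A \<union> B) (insert a (A' \<union> B')). t z = a \<and> overlap A (insert a A') t = r} =
          fact (card B') * falling (card B - 1) (card A' - card r)" using z insert.prems by simp
    qed
    also have "\<dots> = fact (card B') * falling (card B) (card (insert a A') - card r)"
      by (simp add: num falling_Suc)
    finally show ?thesis .
  qed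
qed

text \<open>
The sum runs over the graphs \<open>r\<close> of the partial injections that satisfy \<open>P\<close>, and the product is the
falling factorial of the indeterminate.
\<close>

definition overlap_poly :: "'a set \<Rightarrow> 'b set \<Rightarrow> (('a \<times> 'b) set \<Rightarrow> bool) \<Rightarrow> rat poly" where
  "overlap_poly A A' P =
    (\<Sum>r | r \<subseteq> A \<times> A' \<and> single_valued r \<and> single_valued (r\<inverse>) \<and> P r.
       \<Prod>i<card A' - card r. [:- of_nat i, 1:])"

lemma card_bijs_overlap_poly:
  assumes fin: "finite A" "finite A'" "finite B" "finite B'"
    and disj: "A \<inter> B = {}" "A' \<inter> B' = {}" and card: "card A + card B = card A' + card B'"
  shows "of_nat (card {t \<in> bijs d (A \<union> B) (A' \<union> B'). P (overlap A A' t)}) =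
    fact (card B') * poly (overlap_poly A A' P) (of_nat (card B))"
proof -
  define R where "R = {r. r \<subseteq> A \<times> A' \<and> single_valued r \<and> single_valued (r\<inverse>) \<and> P r}"
  have finR: "finite R"
    by (rule finite_subset[of _ "Pow (A \<times> A')"]) (use fin in \<open>auto simp: R_def\<close>)
  let ?S = "\<lambda>r. {t \<in> bijs d (A \<union> B) (A' \<union> B'). overlap A A' t = r}"
  have in_R: "overlap A A' t \<in> R" if "t \<in> bijs d (A \<union> B) (A' \<union> B')" "P (overlap A A' t)" for t
    using that bijs_inj[OF that(1)] by (auto simp: R_def overlap_def single_valued_def)
  have "{t \<in> bijs d (A \<union> B) (A' \<union> B'). P (overlap A A' t)} = (\<Union>r\<in>R. ?S r)"
    using in_R by (auto simp: R_def)
  also have "card \<dots> = (\<Sum>r\<in>R. card (?S r))"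
    using fin finR by (intro card_UN_disjoint) (auto intro!: finite_bijs)
  also have "\<dots> = (\<Sum>r\<in>R. fact (card B') * falling (card B) (card A' - card r))"
    using assms by (intro sum.cong refl card_bijs_overlap) (auto simp: R_def)
  finally show ?thesis
    by (simp add: overlap_poly_def of_nat_falling poly_sum sum_distrib_left del: of_nat_prod flip: R_def)
qed

lemma permutes_eq_bijs: "{v. v permutes X} = bijs (\<lambda>x. x) X X"
proof (intro equalityI subsetI)
  fix v assume "v \<in> {v. v permutes X}"
  then show "v \<in> bijs (\<lambda>x. x) X X"
    by (simp add: bijs_def permutes_imp_bij permutes_not_in)
next
  fix v assume "v \<in> bijs (\<lambda>x. x) X X"
  then show "v \<in> {v. v permutes X}"
    by (auto simp: bijs_def intro: bij_imp_permutes)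
qed

text \<open>
If the statistics \<open>f\<close> and \<open>f'\<close> vanish outside \<open>A\<close> and \<open>A'\<close>, whether a bijection respects them can be
decided on the overlap: a pair outside the overlap compares a value with 0. This is what makes
the counting condition for \<open>young_scalar\<close> independent of the length of the first row.
\<close>

lemma bijs_invariant_iff_overlap:
  assumes v: "v \<in> bijs d (A \<union> B) (A' \<union> B')" and disj: "A \<inter> B = {}" "A' \<inter> B' = {}"
    and f: "\<And>x. x \<in> B \<Longrightarrow> f x = 0" and f': "\<And>x. x \<in> B' \<Longrightarrow> f' x = (0 :: nat)"
  shows "(\<forall>x\<in>A \<union> B. f' (v x) = f x) \<longleftrightarrow>
    (\<forall>(x, a)\<in>overlap A A' v. f' a = f x) \<and> (\<forall>x\<in>A - Domain (overlap A A' v). f x = 0) \<and>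
    (\<forall>a\<in>A' - Range (overlap A A' v). f' a = 0)"
    (is "?lhs \<longleftrightarrow> ?rhs")
proof
  assume lhs: ?lhs
  have "f x = 0" if "x \<in> A - Domain (overlap A A' v)" for x
  proof -
    have "v x \<in> B'" using that bijs_in[OF v, of x] by (auto simp: overlap_def)
    then show ?thesis using lhs that f' by force
  qed
  moreover have "f' a = 0" if a: "a \<in> A' - Range (overlap A A' v)" for a
  proof -
    obtain x where x: "x \<in> A \<union> B" "v x = a" using bijs_preimage[OF v, of a] a by blast
    then have "x \<in> B" using a by (auto simp: overlap_def)
    then show ?thesis using lhs x f by force
  qed
  ultimately show ?rhs using lhs by (auto simp: overlap_def)
next
  assume rhs: ?rhs
  show ?lhs
  proof
    fix x assume x: "x \<in> A \<union> B"
    consider "x \<in> A" "v x \<in> A'" | "x \<in> A" "v x \<in> B'" | "x \<in> B" "v x \<in> A'" | "x \<in> B" "v x \<in> B'"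
      using x bijs_in[OF v x] by blast
    then show "f' (v x) = f x"
    proof cases
      case 1
      then have "(x, v x) \<in> overlap A A' v" by (auto simp: overlap_def)
      then show ?thesis using rhs by blast
    next
      case 2
      then have "x \<in> A - Domain (overlap A A' v)" using disj by (auto simp: overlap_def)
      then have "f x = 0" using rhs by blast
      then show ?thesis using f'[OF 2(2)] by simp
    next
      case 3
      have "v x \<noteq> v y" if "y \<in> A" for y
        using bijs_inj[OF v, of x y] 3 that disj by blast
      then have "v x \<in> A' - Range (overlap A A' v)" using 3 by (auto simp: overlap_def)
      then have "f' (v x) = 0" using rhs by blast
      then show ?thesis using f[OF 3(1)] by simp
    next
      case 4
      then show ?thesis using f f' by simp
    qed
  qed
qed

text \<open>
The same for the condition that \<open>t\<close> and \<open>g \<circ> t \<circ> q\<close> have equal rows, where \<open>f\<close> is the row number: as \<open>q\<close>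
moves only \<open>A\<close> and \<open>g\<close> moves only \<open>A'\<close>, the cells of \<open>B\<close> stay in place and contribute the value 0, and the
entries in \<open>B'\<close> are fixed by \<open>g\<close>.
\<close>

lemma bijs_fixed_iff_overlap:
  assumes t: "t \<in> bijs d (A \<union> B) (A' \<union> B')" and disj: "A \<inter> B = {}" "A' \<inter> B' = {}"
    and f: "\<And>x. x \<in> B \<Longrightarrow> f x = (0 :: nat)" and q: "q permutes A" and g: "g permutes A'"
  shows "(\<forall>x\<in>A \<union> B. \<forall>y\<in>A \<union> B. t y = g (t (q x)) \<longrightarrow> f y = f x) \<longleftrightarrow>
    (\<forall>x\<in>A. q x \<notin> Domain (overlap A A' t) \<longrightarrow> f (q x) = f x) \<and>
    (\<forall>x\<in>A. \<forall>a. (q x, a) \<in> overlap A A' t \<longrightarrow>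
       (\<forall>y. (y, g a) \<in> overlap A A' t \<longrightarrow> f y = f x) \<and> (g a \<notin> Range (overlap A A' t) \<longrightarrow> f x = 0)) \<and>
    (\<forall>a\<in>A'. a \<notin> Range (overlap A A' t) \<longrightarrow> (\<forall>y. (y, g a) \<in> overlap A A' t \<longrightarrow> f y = 0))"
    (is "?lhs \<longleftrightarrow> ?c1 \<and> ?c2 \<and> ?c3")
proof -
  let ?r = "overlap A A' t"
  have qA: "q x \<in> A" if "x \<in> A" for x using that permutes_in_image[OF q] by blast
  have qB: "q x = x" if "x \<in> B" for x using that disj permutes_not_in[OF q, of x] by blast
  have gA: "g a \<in> A'" if "a \<in> A'" for a using that permutes_in_image[OF g] by blast
  have gB: "g a = a" if "a \<in> B'" for a using that disj permutes_not_in[OF g, of a] by blast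
  have r_iff: "(x, a) \<in> ?r \<longleftrightarrow> x \<in> A \<and> a \<in> A' \<and> t x = a" for x a by (auto simp: overlap_def)
  have tinj: "x = y" if "x \<in> A \<union> B" "y \<in> A \<union> B" "t x = t y" for x y
    using bijs_inj[OF t that] .
  have new: "\<exists>x\<in>B. t x = a" if a: "a \<in> A'" "a \<notin> Range ?r" for a
  proof -
    obtain x where x: "x \<in> A \<union> B" "t x = a" using bijs_preimage[OF t, of a] a by blast
    then have "x \<notin> A" using a r_iff by blast
    with x show ?thesis by blast
  qed
  have notin: "t x \<notin> Range ?r" if "x \<in> B" for x
  proof
    assume "t x \<in> Range ?r"
    then obtain z where "(z, t x) \<in> ?r" by blast
    then have "z \<in> A" "t z = t x" by (simp_all add: r_iff)
    with tinj[of z x] that disj show False by blast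
  qed
  show ?thesis
  proof
    assume lhs: ?lhs
    have ?c1
    proof (intro ballI impI)
      fix x assume x: "x \<in> A" and nd: "q x \<notin> Domain ?r"
      have "t (q x) \<in> B'" using nd qA[OF x] bijs_in[OF t, of "q x"] r_iff by blast
      then have "t (q x) = g (t (q x))" using gB by simp
      then show "f (q x) = f x" using lhs x qA[OF x] by blast
    qed
    moreover have ?c2
    proof (intro ballI allI impI conjI)
      fix x a assume x: "x \<in> A" and a: "(q x, a) \<in> ?r"
      { fix y assume "(y, g a) \<in> ?r"
        then have "y \<in> A" "t y = g (t (q x))" using a by (simp_all add: r_iff)
        then show "f y = f x" using lhs x by blast }
      assume "g a \<notin> Range ?r"
      with new[OF gA] a r_iff obtain y where y: "y \<in> B" "t y = g a" by blast
      then have "t y = g (t (q x))" using a by (simp add: r_iff)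
      then have "f y = f x" using lhs x y by blast
      then show "f x = 0" using f[OF y(1)] by simp
    qed
    moreover have ?c3
    proof (intro ballI allI impI)
      fix a y assume a: "a \<in> A'" "a \<notin> Range ?r" and y: "(y, g a) \<in> ?r"
      obtain x where x: "x \<in> B" "t x = a" using new[OF a] by blast
      then have "t y = g (t (q x))" "y \<in> A" using y qB[OF x(1)] by (simp_all add: r_iff)
      then have "f y = f x" using lhs x by blast
      then show "f y = 0" using f[OF x(1)] by simp
    qed
    ultimately show "?c1 \<and> ?c2 \<and> ?c3" by blast
  next
    assume rhs: "?c1 \<and> ?c2 \<and> ?c3"
    then have c1: ?c1 and c2: ?c2 and c3: ?c3 by blast+
    show ?lhs
    proof (intro ballI impI)
      fix x y assume x: "x \<in> A \<union> B" and y: "y \<in> A \<union> B" and eq: "t y = g (t (q x))"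
      have qx: "q x \<in> A \<union> B" using x qA qB by auto
      show "f y = f x"
      proof (cases "t (q x) \<in> A'")
        case False
        then have "t (q x) \<in> B'" using bijs_in[OF t qx] by blast
        then have "t y = t (q x)" using eq gB by simp
        then have "y = q x" using tinj[OF y qx] by blast
        moreover have "f (q x) = f x"
        proof (cases "x \<in> A")
          case True
          moreover have "q x \<notin> Domain ?r"
          proof
            assume "q x \<in> Domain ?r"
            then obtain a where "(q x, a) \<in> ?r" by blast
            then show False using False by (simp add: r_iff)
          qed
          ultimately show ?thesis using c1 by blast
        next
          case False
          then show ?thesis using x qB by auto
        qed
        ultimately show ?thesis by simp
      next
        case True
        then have tyA: "t y \<in> A'" using eq gA by simp
        show ?thesis
        proof (cases "x \<in> A")
          case xA: True
          then have qr: "(q x, t (q x)) \<in> ?r" using True qA by (simp add: r_iff)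
          show ?thesis
          proof (cases "y \<in> A")
            case True
            then have "(y, g (t (q x))) \<in> ?r" using tyA eq by (simp add: r_iff)
            then show ?thesis using c2 xA qr by blast
          next
            case False
            then have yB: "y \<in> B" using y by blast
            then have "g (t (q x)) \<notin> Range ?r" using notin[OF yB] eq by simp
            then have "f x = 0" using c2 xA qr by blast
            then show ?thesis using f[OF yB] by simp
          qed
        next
          case False
          then have xB: "x \<in> B" using x by blast
          then have tx: "t x \<in> A'" "t x \<notin> Range ?r" "t y = g (t x)" using True notin[OF xB] qB eq by simp_all
          have "f y = 0"
          proof (cases "y \<in> A")
            case True
            then have "(y, g (t x)) \<in> ?r" using tyA tx(3) by (simp add: r_iff)
            then show ?thesis using c3 tx(1,2) by blast
          next
            case False
            then show ?thesis using f y by blast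
          qed
          then show ?thesis using f[OF xB] by simp
        qed
      qed
    qed
  qed
qed

section \<open>The character of a Specht module\<close>

locale shape =
  fixes mu :: "nat list"
  assumes decreasing: "sorted_wrt (\<ge>) mu"
begin

sublocale column_diagram "cells mu"
proof
  have "cells mu = Sigma {..<length mu} (\<lambda>i. {..<mu ! i})" by (auto simp: cells_def)
  then show "finite (cells mu)" by simp
  fix i j i' assume "(i, j) \<in> cells mu" "i' \<le> i"
  then show "(i', j) \<in> cells mu"
    using sorted_wrt_nth_less[OF decreasing, of i' i] by (cases "i' = i") (auto simp: cells_def)
qed

abbreviation "N \<equiv> sum_list mu"

lemma card_cells: "card (cells mu) = N"
proof -
  have "cells mu = Sigma {..<length mu} (\<lambda>i. {..<mu ! i})" by (auto simp: cells_def)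
  then show ?thesis by (simp add: sum_list_sum_nth lessThan_atLeast0)
qed

text \<open>
Setting tableaux to 0 outside the diagram makes them a finite set without losing any polytabloid.
Since permutations of \<open>{1..N}\<close> fix 0, they act on this set by composition.
\<close>

definition tableaux :: "(nat \<times> nat \<Rightarrow> nat) set" where
  "tableaux = bijs (\<lambda>_. 0) (cells mu) {1..N}"

lemma tableaux_bij: "t \<in> tableaux \<Longrightarrow> bij_betw t (cells mu) {1..N}"
  by (simp add: tableaux_def bijs_def)

lemma tableaux_zero: "t \<in> tableaux \<Longrightarrow> x \<notin> cells mu \<Longrightarrow> t x = 0"
  by (simp add: tableaux_def bijs_def del: split_paired_All)

lemma tableauxI: "bij_betw t (cells mu) {1..N} \<Longrightarrow> (\<And>x. x \<notin> cells mu \<Longrightarrow> t x = 0) \<Longrightarrow> t \<in> tableaux"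
  by (simp add: tableaux_def bijs_def)

lemma finite_tableaux: "finite tableaux"
  unfolding tableaux_def by (rule finite_bijs) (simp_all add: finite_X)

lemma tableaux_inj: "t \<in> tableaux \<Longrightarrow> x \<in> cells mu \<Longrightarrow> y \<in> cells mu \<Longrightarrow> t x = t y \<longleftrightarrow> x = y"
  by (metis tableaux_bij bij_betw_def inj_on_eq_iff)

lemma tableau_comp:
  assumes t: "t \<in> tableaux" and w: "w permutes cells mu"
  shows "t \<circ> w \<in> tableaux"
proof (rule tableauxI)
  show "bij_betw (t \<circ> w) (cells mu) {1..N}"
    by (rule bij_betw_trans[OF permutes_imp_bij[OF w] tableaux_bij[OF t]])
  show "(t \<circ> w) x = 0" if "x \<notin> cells mu" for x
    using that tableaux_zero[OF t] permutes_not_in[OF w] by simp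
qed

lemma perm_tableau:
  assumes t: "t \<in> tableaux" and \<sigma>: "\<sigma> permutes {1..N}"
  shows "\<sigma> \<circ> t \<in> tableaux"
proof (rule tableauxI)
  show "bij_betw (\<sigma> \<circ> t) (cells mu) {1..N}"
    by (rule bij_betw_trans[OF tableaux_bij[OF t] permutes_imp_bij[OF \<sigma>]])
  show "(\<sigma> \<circ> t) x = 0" if "x \<notin> cells mu" for x
    using that tableaux_zero[OF t] permutes_not_in[OF \<sigma>, of 0] by simp
qed

lemma tableau_comp_surj:
  assumes s: "s \<in> tableaux" and t: "t \<in> tableaux"
  shows "\<exists>w. w permutes cells mu \<and> s = t \<circ> w"
proof -
  define w where "w x = (if x \<in> cells mu then inv_into (cells mu) t (s x) else x)" for x
  have "bij_betw (\<lambda>x. inv_into (cells mu) t (s x)) (cells mu) (cells mu)"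
    using bij_betw_trans[OF tableaux_bij[OF s] bij_betw_inv_into[OF tableaux_bij[OF t]]]
    by (simp add: comp_def)
  then have "bij_betw w (cells mu) (cells mu)"
    by (subst bij_betw_cong[of _ _ "\<lambda>x. inv_into (cells mu) t (s x)"]) (auto simp: w_def)
  then have w: "w permutes cells mu" by (rule bij_imp_permutes) (simp add: w_def)
  have "s x = t (w x)" for x
  proof (cases "x \<in> cells mu")
    case True
    then have "s x \<in> t ` cells mu"
      using tableaux_bij[OF s] tableaux_bij[OF t] by (auto simp: bij_betw_def)
    then show ?thesis using True by (simp add: w_def f_inv_into_f)
  next
    case False
    then show ?thesis using tableaux_zero[OF s False] tableaux_zero[OF t False] by (simp add: w_def)
  qed
  then show ?thesis using w by (intro exI[of _ w]) auto
qed

lemma sum_tableaux: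
  assumes t: "t \<in> tableaux"
  shows "(\<Sum>s\<in>tableaux. F s) = (\<Sum>w | w permutes cells mu. F (t \<circ> w))"
proof -
  have "inj_on ((\<circ>) t) {w. w permutes cells mu}"
  proof (rule inj_onI)
    fix w w' assume w: "w \<in> {w. w permutes cells mu}" "w' \<in> {w. w permutes cells mu}" and eq: "t \<circ> w = t \<circ> w'"
    show "w = w'"
    proof
      fix x show "w x = w' x"
      proof (cases "x \<in> cells mu")
        case True
        have "t (w x) = t (w' x)" using fun_cong[OF eq, of x] by simp
        moreover have "w x \<in> cells mu" "w' x \<in> cells mu"
          using w True permutes_in_image[of _ "cells mu" x] by blast+
        ultimately show ?thesis using tableaux_inj[OF t] by blast
      next
        case False
        then show ?thesis using w by (simp add: permutes_not_in)
      qed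
    qed
  qed
  moreover have "(\<circ>) t ` {w. w permutes cells mu} = tableaux"
    using tableau_comp[OF t] tableau_comp_surj[OF _ t] by blast
  ultimately show ?thesis
    using sum.reindex[of "(\<circ>) t" "{w. w permutes cells mu}" F] by (simp add: comp_def)
qed

lemma tabloid_eq_iff:
  assumes s: "s \<in> tableaux" and t: "t \<in> tableaux"
  shows "tabloid mu s = tabloid mu t \<longleftrightarrow> (\<forall>x\<in>cells mu. \<forall>y\<in>cells mu. s x = t y \<longrightarrow> fst x = fst y)"
proof -
  have eq: "tabloid mu s = tabloid mu t \<longleftrightarrow>
      (\<forall>i<length mu. {s (i, j) | j. j < mu ! i} = {t (i, j) | j. j < mu ! i})"
    by (simp only: tabloid_def map_eq_conv set_upt atLeast0LessThan Ball_def lessThan_iff)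
  have sub: "{s (i, j) | j. j < mu ! i} \<subseteq> {t (i, j) | j. j < mu ! i}"
    if s: "s \<in> tableaux" and t: "t \<in> tableaux" and i: "i < length mu"
      and *: "\<And>x y. x \<in> cells mu \<Longrightarrow> y \<in> cells mu \<Longrightarrow> s x = t y \<Longrightarrow> fst x = fst y" for s t i
  proof
    fix v assume "v \<in> {s (i, j) | j. j < mu ! i}"
    then obtain j where j: "j < mu ! i" "v = s (i, j)" by blast
    then have c: "(i, j) \<in> cells mu" using i by (simp add: cells_def)
    then have "v \<in> t ` cells mu"
      using j tableaux_bij[OF s] tableaux_bij[OF t] by (auto simp: bij_betw_def)
    then obtain y where y: "y \<in> cells mu" "v = t y" by blast
    with *[OF c y(1)] j have "fst y = i" by simp
    then obtain j' where "y = (i, j')" by (metis prod.collapse)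
    with y(1) have "j' < mu ! i" by (simp add: cells_def)
    with y(2) \<open>y = (i, j')\<close> show "v \<in> {t (i, j) | j. j < mu ! i}" by blast
  qed
  show ?thesis unfolding eq
  proof
    assume rows: "\<forall>i<length mu. {s (i, j) | j. j < mu ! i} = {t (i, j) | j. j < mu ! i}"
    show "\<forall>x\<in>cells mu. \<forall>y\<in>cells mu. s x = t y \<longrightarrow> fst x = fst y"
    proof (intro ballI impI)
      fix x y assume x: "x \<in> cells mu" and y: "y \<in> cells mu" and eq: "s x = t y"
      obtain i j where ij: "x = (i, j)" "i < length mu" "j < mu ! i" using x by (auto simp: cells_def)
      then have "s x \<in> {t (i, j) | j. j < mu ! i}" using rows by blast
      then obtain j' where j': "j' < mu ! i" "s x = t (i, j')" by blast
      then have "(i, j') \<in> cells mu" using ij by (simp add: cells_def)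
      with j' eq have "y = (i, j')" using tableaux_inj[OF t y] by simp
      then show "fst x = fst y" using ij by simp
    qed
  next
    assume *: "\<forall>x\<in>cells mu. \<forall>y\<in>cells mu. s x = t y \<longrightarrow> fst x = fst y"
    show "\<forall>i<length mu. {s (i, j) | j. j < mu ! i} = {t (i, j) | j. j < mu ! i}"
    proof (intro allI impI equalityI)
      fix i assume i: "i < length mu"
      show "{s (i, j) | j. j < mu ! i} \<subseteq> {t (i, j) | j. j < mu ! i}"
        using * by (intro sub[OF s t i]) blast
      show "{t (i, j) | j. j < mu ! i} \<subseteq> {s (i, j) | j. j < mu ! i}"
        using * by (intro sub[OF t s i]) (metis (no_types))
    qed
  qed
qed

lemma tabloid_comp_eq_iff:
  assumes t: "t \<in> tableaux" and w: "w permutes cells mu" and w': "w' permutes cells mu"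
  shows "tabloid mu (t \<circ> w) = tabloid mu (t \<circ> w') \<longleftrightarrow> inv w' \<circ> w \<in> row_group"
  unfolding tabloid_eq_iff[OF tableau_comp[OF t w] tableau_comp[OF t w']]
proof
  assume *: "\<forall>x\<in>cells mu. \<forall>y\<in>cells mu. (t \<circ> w) x = (t \<circ> w') y \<longrightarrow> fst x = fst y"
  show "inv w' \<circ> w \<in> row_group"
  proof (rule row_groupI)
    show p: "inv w' \<circ> w permutes cells mu" by (intro permutes_compose permutes_inv w w')
    fix x show "fst ((inv w' \<circ> w) x) = fst x"
    proof (cases "x \<in> cells mu")
      case True
      then have mem: "(inv w' \<circ> w) x \<in> cells mu" by (simp only: permutes_in_image[OF p])
      have "(t \<circ> w) x = (t \<circ> w') ((inv w' \<circ> w) x)"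
        using permutes_inverses(1)[OF w'] by simp
      with bspec[OF bspec[OF * True] mem] have "fst x = fst ((inv w' \<circ> w) x)" by (rule mp)
      then show ?thesis by simp
    next
      case False
      then show ?thesis using permutes_not_in[OF p, of x] by simp
    qed
  qed
next
  assume r: "inv w' \<circ> w \<in> row_group"
  show "\<forall>x\<in>cells mu. \<forall>y\<in>cells mu. (t \<circ> w) x = (t \<circ> w') y \<longrightarrow> fst x = fst y"
  proof (intro ballI impI)
    fix x y assume x: "x \<in> cells mu" and y: "y \<in> cells mu" and eq: "(t \<circ> w) x = (t \<circ> w') y"
    have "w x \<in> cells mu" "w' y \<in> cells mu"
      using x y permutes_in_image[OF w] permutes_in_image[OF w'] by blast+
    then have "w x = w' y" using eq tableaux_inj[OF t] by simp
    then have "(inv w' \<circ> w) x = y" using permutes_inverses(2)[OF w'] by simp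
    then show "fst x = fst y" using row_groupD(2)[OF r, of x] by simp
  qed
qed

lemma polytabloid_cong:
  assumes "\<And>x. x \<in> cells mu \<Longrightarrow> s x = t x"
  shows "polytabloid mu s = polytabloid mu t"
proof -
  have "column mu s j = column mu t j" for j
    using assms by (force simp: column_def)
  then have "column_stabilizer mu s = column_stabilizer mu t" by (simp add: column_stabilizer_def)
  moreover have "tabloid mu (\<pi> \<circ> s) = tabloid mu (\<pi> \<circ> t)" for \<pi>
    unfolding tabloid_def
  proof (intro map_cong refl Collect_cong)
    fix i v assume "i \<in> set [0..<length mu]"
    then have "s (i, j) = t (i, j)" if "j < mu ! i" for j using assms that by (simp add: cells_def)
    then show "(\<exists>j. v = (\<pi> \<circ> s) (i, j) \<and> j < mu ! i) = (\<exists>j. v = (\<pi> \<circ> t) (i, j) \<and> j < mu ! i)"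
      by (intro ex_cong1) auto
  qed
  ultimately show ?thesis by (simp add: polytabloid_def)
qed

lemma specht_module_eq: "specht_module mu = cfun.span (polytabloid mu ` tableaux)"
proof -
  have "{polytabloid mu t | t. is_tableau mu t} = polytabloid mu ` tableaux"
  proof
    show "polytabloid mu ` tableaux \<subseteq> {polytabloid mu t | t. is_tableau mu t}"
      using tableaux_bij by (auto simp: is_tableau_def)
    show "{polytabloid mu t | t. is_tableau mu t} \<subseteq> polytabloid mu ` tableaux"
    proof
      fix e assume "e \<in> {polytabloid mu t | t. is_tableau mu t}"
      then obtain t where t: "bij_betw t (cells mu) {1..N}" "e = polytabloid mu t"
        by (auto simp: is_tableau_def)
      define t' where "t' x = (if x \<in> cells mu then t x else 0)" for x
      have "bij_betw t' (cells mu) {1..N}"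
        using t(1) by (subst bij_betw_cong[of _ _ t]) (auto simp: t'_def)
      then have "t' \<in> tableaux" by (rule tableauxI) (simp add: t'_def)
      moreover have "e = polytabloid mu t'" unfolding t(2) by (rule polytabloid_cong) (simp add: t'_def)
      ultimately show "e \<in> polytabloid mu ` tableaux" by blast
    qed
  qed
  then show ?thesis by (simp add: specht_module_def)
qed

text \<open>
A tableau transports the column permutations of the diagram to its column stabilizer. The sum
over the latter, which varies with \<open>t\<close>, becomes a sum over a group that only depends on the shape.
\<close>

lemma polytabloid_eq:
  assumes t: "t \<in> tableaux"
  shows "polytabloid mu t T = of_int (\<Sum>q\<in>col_group. if T = tabloid mu (t \<circ> q) then sign q else 0)"
proof -
  let ?X = "cells mu" and ?m = "map_permutation (cells mu) t"
  have bij: "bij_betw t ?X {1..N}" and inj: "inj_on t ?X" and img: "t ` ?X = {1..N}"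
    using tableaux_bij[OF t] by (auto simp: bij_betw_def)
  have m: "?m q permutes {1..N}" if "q permutes ?X" for q
    by (rule map_permutation_permutes[OF bij that])
  have m_t: "?m q (t x) = t (q x)" if "x \<in> ?X" for q x
    by (rule map_permutation_apply[OF inj that])
  have column: "column mu t j = t ` {x \<in> ?X. snd x = j}" for j
    by (auto simp: column_def)
  have col_iff: "?m q \<in> column_stabilizer mu t \<longleftrightarrow> q \<in> col_group" if q: "q permutes ?X" for q
  proof
    assume "q \<in> col_group"
    have "?m q ` column mu t j = column mu t j" for j
    proof -
      have "q ` {x \<in> ?X. snd x = j} = {x \<in> ?X. snd x = j}"
      proof
        show "q ` {x \<in> ?X. snd x = j} \<subseteq> {x \<in> ?X. snd x = j}"
          using col_groupD(2)[OF \<open>q \<in> col_group\<close>] permutes_in_image[OF q] by auto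
        show "{x \<in> ?X. snd x = j} \<subseteq> q ` {x \<in> ?X. snd x = j}"
        proof
          fix x assume "x \<in> {x \<in> ?X. snd x = j}"
          then have "inv q x \<in> {x \<in> ?X. snd x = j}"
            using col_groupD(2)[OF col_group_inv[OF \<open>q \<in> col_group\<close>]] permutes_in_image[OF permutes_inv[OF q]] by auto
          then show "x \<in> q ` {x \<in> ?X. snd x = j}" using permutes_inverses(1)[OF q, of x] by (metis imageI)
        qed
      qed
      moreover have "?m q ` t ` {x \<in> ?X. snd x = j} = t ` q ` {x \<in> ?X. snd x = j}"
        unfolding image_image by (intro image_cong refl m_t) simp
      ultimately show ?thesis unfolding column by simp
    qed
    then show "?m q \<in> column_stabilizer mu t" using m[OF q] by (simp add: column_stabilizer_def)
  next
    assume *: "?m q \<in> column_stabilizer mu t"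
    show "q \<in> col_group"
    proof (rule col_groupI[OF q])
      fix x show "snd (q x) = snd x"
      proof (cases "x \<in> ?X")
        case True
        then have qx: "q x \<in> ?X" by (simp only: permutes_in_image[OF q])
        have "t x \<in> column mu t (snd x)" using True by (simp add: column)
        then have "?m q (t x) \<in> column mu t (snd x)" using * by (auto simp: column_stabilizer_def)
        then have "t (q x) \<in> t ` {y \<in> ?X. snd y = snd x}" using m_t[OF True] column by simp
        then obtain y where y: "y \<in> ?X" "snd y = snd x" "t (q x) = t y" by blast
        then have "q x = y" using tableaux_inj[OF t qx y(1)] by blast
        then show ?thesis using y(2) by simp
      next
        case False
        then show ?thesis using permutes_not_in[OF q] by simp
      qed
    qed
  qed
  have m_inj: "inj_on ?m col_group"
  proof (rule inj_onI)
    fix q q' assume q: "q \<in> col_group" and q': "q' \<in> col_group" and eq: "?m q = ?m q'"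
    show "q = q'"
    proof
      fix x show "q x = q' x"
      proof (cases "x \<in> ?X")
        case True
        then have "t (q x) = t (q' x)" using m_t[OF True, of q] m_t[OF True, of q'] eq by simp
        moreover have "q x \<in> ?X" "q' x \<in> ?X"
          using True permutes_in_image[OF col_groupD(1)[OF q]] permutes_in_image[OF col_groupD(1)[OF q']] by blast+
        ultimately show ?thesis using tableaux_inj[OF t] by simp
      next
        case False
        then show ?thesis using permutes_not_in col_groupD(1) q q' by metis
      qed
    qed
  qed
  have m_surj: "?m ` col_group = column_stabilizer mu t"
  proof
    show "?m ` col_group \<subseteq> column_stabilizer mu t" using col_iff col_groupD(1) by blast
    show "column_stabilizer mu t \<subseteq> ?m ` col_group"
    proof
      fix \<pi> assume \<pi>: "\<pi> \<in> column_stabilizer mu t"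
      then have \<pi>p: "\<pi> permutes {1..N}" by (simp add: column_stabilizer_def)
      obtain q where q: "q permutes ?X" "\<pi> \<circ> t = t \<circ> q"
        using tableau_comp_surj[OF perm_tableau[OF t \<pi>p] t] by blast
      have "\<pi> v = ?m q v" for v
      proof (cases "v \<in> {1..N}")
        case True
        then obtain x where x: "x \<in> ?X" "v = t x" using img by blast
        then show ?thesis using m_t[OF x(1)] fun_cong[OF q(2), of x] by simp
      next
        case False
        then show ?thesis using permutes_not_in[OF \<pi>p] permutes_not_in[OF m[OF q(1)]] by simp
      qed
      then have "\<pi> = ?m q" by blast
      then show "\<pi> \<in> ?m ` col_group" using col_iff[OF q(1)] \<pi> by blast
    qed
  qed
  have "polytabloid mu t T = (\<Sum>\<pi>\<in>column_stabilizer mu t. if T = tabloid mu (\<pi> \<circ> t) then of_int (sign \<pi>) else 0)"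
    by (simp add: polytabloid_def sum_fun_apply)
  also have "\<dots> = (\<Sum>q\<in>col_group. if T = tabloid mu (?m q \<circ> t) then of_int (sign (?m q)) else 0)"
    unfolding m_surj[symmetric] by (subst sum.reindex[OF m_inj]) (simp add: comp_def)
  also have "\<dots> = (\<Sum>q\<in>col_group. of_int (if T = tabloid mu (t \<circ> q) then sign q else 0))"
  proof (intro sum.cong refl)
    fix q assume q: "q \<in> col_group"
    have "tabloid mu (?m q \<circ> t) = tabloid mu (t \<circ> q)"
      unfolding tabloid_def
    proof (intro map_cong refl Collect_cong)
      fix i v assume "i \<in> set [0..<length mu]"
      then have "?m q (t (i, j)) = t (q (i, j))" if "j < mu ! i" for j
        using m_t that by (simp add: cells_def)
      then show "(\<exists>j. v = (?m q \<circ> t) (i, j) \<and> j < mu ! i) = (\<exists>j. v = (t \<circ> q) (i, j) \<and> j < mu ! i)"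
        by (intro ex_cong1) auto
    qed
    moreover have "sign (?m q) = sign q"
      by (rule sign_map_permutation[OF inj col_groupD(1)[OF q] finite_X])
    ultimately show "(if T = tabloid mu (?m q \<circ> t) then of_int (sign (?m q)) else 0) =
        (of_int (if T = tabloid mu (t \<circ> q) then sign q else 0) :: complex)" by simp
  qed
  finally show ?thesis by simp
qed

lemma polytabloid_coeff:
  assumes t: "t \<in> tableaux" and w: "w permutes cells mu"
  shows "polytabloid mu t (tabloid mu (t \<circ> w)) = of_int (young_coeff w)"
  unfolding polytabloid_eq[OF t] young_coeff_def
  using tabloid_comp_eq_iff[OF t w col_groupD(1)] by (intro arg_cong[of _ _ of_int] sum.cong) auto

lemma polytabloid_supp:
  assumes t: "t \<in> tableaux" and T: "T \<notin> tabloid mu ` tableaux"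
  shows "polytabloid mu t T = 0"
proof -
  have "T \<noteq> tabloid mu (t \<circ> q)" if "q \<in> col_group" for q
    using T tableau_comp[OF t col_groupD(1)[OF that]] by blast
  then show ?thesis unfolding polytabloid_eq[OF t] by simp
qed

lemma perm_act_polytabloid:
  assumes t: "t \<in> tableaux" and \<sigma>: "\<sigma> permutes {1..N}"
  shows "perm_act \<sigma> (polytabloid mu t) = polytabloid mu (\<sigma> \<circ> t)"
proof
  fix T
  have "map ((`) (inv \<sigma>)) T = tabloid mu (t \<circ> q) \<longleftrightarrow> T = tabloid mu (\<sigma> \<circ> t \<circ> q)" for q
  proof -
    have tab: "tabloid mu (\<sigma> \<circ> t \<circ> q) = map ((`) \<sigma>) (tabloid mu (t \<circ> q))"
      by (auto simp: tabloid_def)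
    have "map ((`) \<sigma>) (map ((`) (inv \<sigma>)) L) = L" "map ((`) (inv \<sigma>)) (map ((`) \<sigma>) L) = L" for L
      by (simp_all add: comp_def image_image permutes_inverses[OF \<sigma>])
    then show ?thesis unfolding tab by metis
  qed
  then show "perm_act \<sigma> (polytabloid mu t) T = polytabloid mu (\<sigma> \<circ> t) T"
    unfolding perm_act_def polytabloid_eq[OF t] polytabloid_eq[OF perm_tableau[OF t \<sigma>]] by simp
qed

text \<open>
The map that sends a tabloid to the sum of the polytabloids of its tableaux acts on the Specht
module as the scalar \<open>young_scalar\<close>. By \<open>polytabloid_coeff\<close> this is the statement about the square of
the Young symmetrizer.
\<close>

lemma polytabloid_projection:
  assumes t: "t \<in> tableaux"
  shows "(\<Sum>s\<in>tableaux. (\<lambda>T. polytabloid mu t (tabloid mu s) * polytabloid mu s T)) =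
    (\<lambda>T. of_int young_scalar * polytabloid mu t T)"
proof
  fix T
  show "(\<Sum>s\<in>tableaux. (\<lambda>T. polytabloid mu t (tabloid mu s) * polytabloid mu s T)) T =
      of_int young_scalar * polytabloid mu t T"
  proof (cases "T \<in> tabloid mu ` tableaux")
    case False
    then show ?thesis using polytabloid_supp t by (simp add: sum_fun_apply)
  next
    case True
    then obtain w where w: "w permutes cells mu" and T: "T = tabloid mu (t \<circ> w)"
      using tableau_comp_surj[OF _ t] by blast
    have "(\<Sum>s\<in>tableaux. polytabloid mu t (tabloid mu s) * polytabloid mu s T) =
        (\<Sum>v | v permutes cells mu. polytabloid mu t (tabloid mu (t \<circ> v)) * polytabloid mu (t \<circ> v) T)"
      by (rule sum_tableaux[OF t])
    also have "\<dots> = (\<Sum>v | v permutes cells mu. of_int (young_coeff v * young_coeff (inv v \<circ> w)))"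
    proof (intro sum.cong refl)
      fix v assume "v \<in> {v. v permutes cells mu}"
      then have v: "v permutes cells mu" by simp
      have vw: "inv v \<circ> w permutes cells mu" by (intro permutes_compose permutes_inv v w)
      have "T = tabloid mu ((t \<circ> v) \<circ> (inv v \<circ> w))"
        unfolding T using permutes_inv_o(1)[OF v] by (metis comp_assoc comp_id)
      then show "polytabloid mu t (tabloid mu (t \<circ> v)) * polytabloid mu (t \<circ> v) T =
          of_int (young_coeff v * young_coeff (inv v \<circ> w))"
        using polytabloid_coeff[OF t v] polytabloid_coeff[OF tableau_comp[OF t v] vw] by simp
    qed
    also have "\<dots> = of_int (\<Sum>v | v permutes cells mu. young_coeff v * young_coeff (inv v \<circ> w))" by simp
    also have "\<dots> = of_int young_scalar * polytabloid mu t T"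
      unfolding young_coeff_convolution[OF w] T polytabloid_coeff[OF t w] by simp
    finally show ?thesis by (simp add: sum_fun_apply)
  qed
qed

text \<open>
For permutations \<open>\<sigma>\<close> of the entries and \<open>q\<close> of the cells, these are the tableaux \<open>t\<close> with the same
tabloid as \<open>\<sigma> \<circ> t \<circ> q\<close>.
\<close>

definition fixed_tableaux :: "(nat \<Rightarrow> nat) \<Rightarrow> (nat \<times> nat \<Rightarrow> nat \<times> nat) \<Rightarrow> (nat \<times> nat \<Rightarrow> nat) set" where
  "fixed_tableaux \<sigma> q = {t \<in> tableaux. \<forall>x\<in>cells mu. \<forall>y\<in>cells mu. t y = \<sigma> (t (q x)) \<longrightarrow> fst y = fst x}"

text \<open>
Compose \<open>\<sigma>\<close> with the map of \<open>polytabloid_projection\<close> and take the trace on the permutation module. The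
diagonal entry at a tabloid is the sum, over its tableaux \<open>t\<close>, of the coefficient of that tabloid
in the polytabloid of \<open>\<sigma> \<circ> t\<close>.
\<close>

lemma irr_char_formula:
  assumes \<sigma>: "\<sigma> permutes {1..N}"
  shows "of_int young_scalar * irr_char mu \<sigma> = of_int (\<Sum>q\<in>col_group. sign q * int (card (fixed_tableaux \<sigma> q)))"
    and "irr_char mu \<sigma> \<in> \<int>"
proof -
  have c: "(of_int young_scalar :: complex) \<noteq> 0" using young_scalar_pos by simp
  have into: "perm_act \<sigma> (polytabloid mu s) \<in> polytabloid mu ` tableaux" if "s \<in> tableaux" for s
    unfolding perm_act_polytabloid[OF that \<sigma>] using perm_tableau[OF that \<sigma>] by blast
  have int: "polytabloid mu s T \<in> \<int>" if "s \<in> tableaux" for s T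
    unfolding polytabloid_eq[OF that] by (rule Ints_of_int)
  have add: "perm_act \<sigma> (u + v) = perm_act \<sigma> u + perm_act \<sigma> v" for u v
    by (simp add: perm_act_def fun_eq_iff)
  have scale: "perm_act \<sigma> (\<lambda>T. a * u T) = (\<lambda>T. a * perm_act \<sigma> u T)" for a u
    by (simp add: perm_act_def)
  note trace = trace_on_eq_and_Ints[where f = "perm_act \<sigma>" and e = "polytabloid mu" and I = tableaux
      and X = "tabloid mu ` tableaux" and key = "tabloid mu", OF add scale into finite_tableaux
      finite_imageI[OF finite_tableaux] int polytabloid_supp polytabloid_projection c]
  show "irr_char mu \<sigma> \<in> \<int>"
    unfolding irr_char_def specht_module_eq by (rule trace(2))
  have "of_int young_scalar * irr_char mu \<sigma> = (\<Sum>s\<in>tableaux. perm_act \<sigma> (polytabloid mu s) (tabloid mu s))"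
    unfolding irr_char_def specht_module_eq by (rule trace(1))
  also have "\<dots> = (\<Sum>s\<in>tableaux. of_int (\<Sum>q\<in>col_group. if s \<in> fixed_tableaux \<sigma> q then sign q else 0))"
  proof (intro sum.cong refl)
    fix s assume s: "s \<in> tableaux"
    have "tabloid mu s = tabloid mu (\<sigma> \<circ> s \<circ> q) \<longleftrightarrow> s \<in> fixed_tableaux \<sigma> q" if "q \<in> col_group" for q
      unfolding tabloid_eq_iff[OF s tableau_comp[OF perm_tableau[OF s \<sigma>] col_groupD(1)[OF that]]] fixed_tableaux_def
      using s by auto
    then show "perm_act \<sigma> (polytabloid mu s) (tabloid mu s) =
        of_int (\<Sum>q\<in>col_group. if s \<in> fixed_tableaux \<sigma> q then sign q else 0)"
      unfolding perm_act_polytabloid[OF s \<sigma>] polytabloid_eq[OF perm_tableau[OF s \<sigma>]]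
      by (intro arg_cong[of _ _ of_int] sum.cong) auto
  qed
  also have "\<dots> = of_int (\<Sum>q\<in>col_group. \<Sum>s\<in>tableaux. if s \<in> fixed_tableaux \<sigma> q then sign q else 0)"
    by (subst sum.swap) simp
  also have "(\<Sum>q\<in>col_group. \<Sum>s\<in>tableaux. if s \<in> fixed_tableaux \<sigma> q then sign q else 0) =
      (\<Sum>q\<in>col_group. sign q * int (card (fixed_tableaux \<sigma> q)))"
  proof (intro sum.cong refl)
    fix q
    have "(\<Sum>s\<in>tableaux. if s \<in> fixed_tableaux \<sigma> q then sign q else 0) = (\<Sum>s\<in>tableaux \<inter> fixed_tableaux \<sigma> q. sign q)"
      by (rule sum.inter_restrict[OF finite_tableaux, symmetric])
    also have "tableaux \<inter> fixed_tableaux \<sigma> q = fixed_tableaux \<sigma> q" by (auto simp: fixed_tableaux_def)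
    finally show "(\<Sum>s\<in>tableaux. if s \<in> fixed_tableaux \<sigma> q then sign q else 0) = sign q * int (card (fixed_tableaux \<sigma> q))"
      by simp
  qed
  finally show "of_int young_scalar * irr_char mu \<sigma> = of_int (\<Sum>q\<in>col_group. sign q * int (card (fixed_tableaux \<sigma> q)))" .
qed

lemma card_fixed_tableaux_conjugate:
  assumes \<sigma>: "\<sigma> permutes {1..N}" and \<tau>: "\<tau> permutes {1..N}" and \<phi>: "\<phi> permutes {1..N}"
    and conj: "\<And>v. v \<in> {1..N} \<Longrightarrow> \<phi> (\<sigma> v) = \<tau> (\<phi> v)" and q: "q permutes cells mu"
  shows "card (fixed_tableaux \<sigma> q) = card (fixed_tableaux \<tau> q)"
proof (rule bij_betw_same_card)
  have iff: "\<phi> \<circ> t \<in> fixed_tableaux \<tau> q \<longleftrightarrow> t \<in> fixed_tableaux \<sigma> q" if t: "t \<in> tableaux" for t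
  proof -
    have "(\<phi> \<circ> t) y = \<tau> ((\<phi> \<circ> t) (q x)) \<longleftrightarrow> t y = \<sigma> (t (q x))" if "x \<in> cells mu" "y \<in> cells mu" for x y
    proof -
      have "q x \<in> cells mu" using that permutes_in_image[OF q] by blast
      then have "t (q x) \<in> {1..N}" using bij_betwE[OF tableaux_bij[OF t]] by blast
      then have "\<tau> (\<phi> (t (q x))) = \<phi> (\<sigma> (t (q x)))" using conj by simp
      then show ?thesis using permutes_inj[OF \<phi>] by (simp add: inj_eq)
    qed
    then show ?thesis using t perm_tableau[OF t \<phi>] by (simp add: fixed_tableaux_def)
  qed
  show "bij_betw (\<lambda>t. \<phi> \<circ> t) (fixed_tableaux \<sigma> q) (fixed_tableaux \<tau> q)"
  proof (rule bij_betw_byWitness[where f' = "\<lambda>t. inv \<phi> \<circ> t"])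
    have inv: "inv \<phi> \<circ> (\<phi> \<circ> t) = t" "\<phi> \<circ> (inv \<phi> \<circ> t) = t" for t
      using permutes_inv_o[OF \<phi>] by (metis comp_assoc id_comp)+
    show "\<forall>t\<in>fixed_tableaux \<sigma> q. inv \<phi> \<circ> (\<phi> \<circ> t) = t" "\<forall>t\<in>fixed_tableaux \<tau> q. \<phi> \<circ> (inv \<phi> \<circ> t) = t"
      using inv by blast+
    have sub: "fixed_tableaux \<rho> q \<subseteq> tableaux" for \<rho> by (auto simp: fixed_tableaux_def)
    show "(\<lambda>t. \<phi> \<circ> t) ` fixed_tableaux \<sigma> q \<subseteq> fixed_tableaux \<tau> q" using iff sub by blast
    show "(\<lambda>t. inv \<phi> \<circ> t) ` fixed_tableaux \<tau> q \<subseteq> fixed_tableaux \<sigma> q"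
    proof (intro image_subsetI)
      fix t assume t: "t \<in> fixed_tableaux \<tau> q"
      then have "inv \<phi> \<circ> t \<in> tableaux" using sub perm_tableau[OF _ permutes_inv[OF \<phi>]] by blast
      from iff[OF this] show "inv \<phi> \<circ> t \<in> fixed_tableaux \<sigma> q" unfolding inv(2) using t by blast
    qed
  qed
qed

text \<open>
Conjugating \<open>\<sigma>\<close> only relabels the tableaux counted by the character formula, so the character is
constant on the permutations of a given cycle type.
\<close>

lemma irr_char_at_eq:
  assumes g: "g permutes {1..N}" and type: "cycle_type N g = mset \<alpha>"
  shows "irr_char_at mu \<alpha> = irr_char mu g"
  unfolding irr_char_at_def
proof (rule the_equality)
  show "\<forall>\<sigma>. \<sigma> permutes {1..N} \<and> cycle_type N \<sigma> = mset \<alpha> \<longrightarrow> irr_char mu \<sigma> = irr_char mu g"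
  proof (intro allI impI)
    fix \<sigma> assume \<sigma>: "\<sigma> permutes {1..N} \<and> cycle_type N \<sigma> = mset \<alpha>"
    then obtain \<phi> where \<phi>: "\<phi> permutes {1..N}" "\<forall>v\<in>{1..N}. \<phi> (\<sigma> v) = g (\<phi> v)"
      using same_orbit_sizes_conjugate[of \<sigma> "{1..N}" g] g type by (auto simp: cycle_type_def)
    have "(of_int young_scalar :: complex) * irr_char mu \<sigma> = of_int young_scalar * irr_char mu g"
      unfolding irr_char_formula(1)[OF conjunct1[OF \<sigma>]] irr_char_formula(1)[OF g]
      using card_fixed_tableaux_conjugate[OF conjunct1[OF \<sigma>] g \<phi>(1)] \<phi>(2) col_groupD(1)
      by (intro arg_cong[of _ _ of_int] sum.cong) auto
    then show "irr_char mu \<sigma> = irr_char mu g" using young_scalar_pos by simp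
  qed
qed (use g type in blast)

end

section \<open>Long first rows\<close>

text \<open>
The shapes \<open>n # lam\<close> for varying \<open>n\<close>. For \<open>n \<ge> width\<close> the diagram is the disjoint union of a core
that does not depend on \<open>n\<close> and an arm in row 0 whose columns have a single cell. If \<open>lam\<close> is empty,
the width is 0, and every \<open>n\<close> including 0 gives a shape with empty core.
\<close>

locale shape_tail =
  fixes lam :: "nat list"
  assumes decreasing_tail: "sorted_wrt (\<ge>) lam"
begin

definition width :: nat where "width = (if lam = [] then 0 else hd lam)"

definition core :: "(nat \<times> nat) set" where "core = cells (width # lam)"

definition arm :: "nat \<Rightarrow> (nat \<times> nat) set" where "arm n = {0} \<times> {width..<n}"

lemma row_le_width: "x \<in> set lam \<Longrightarrow> x \<le> width"
  unfolding width_def using decreasing_tail by (cases lam) auto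

lemma shape_Cons:
  assumes "width \<le> n" shows "shape (n # lam)"
proof
  have "y \<le> n" if "y \<in> set lam" for y using row_le_width[OF that] assms by simp
  then show "sorted_wrt (\<ge>) (n # lam)" using decreasing_tail by simp
qed

lemma core_snd: "(i, j) \<in> core \<Longrightarrow> j < width"
proof -
  assume "(i, j) \<in> core"
  then show "j < width"
    using row_le_width[of "lam ! (i - 1)"] by (cases i) (auto simp: core_def cells_def)
qed

lemma cells_Cons: "width \<le> n \<Longrightarrow> cells (n # lam) = core \<union> arm n"
  by (auto simp: core_def arm_def cells_def nth_Cons split: nat.splits)

lemma core_arm_disjoint: "core \<inter> arm n = {}"
  using core_snd by (fastforce simp: arm_def)

lemma finite_core: "finite core"
proof -
  interpret shape "width # lam" by (rule shape_Cons) simp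
  show ?thesis unfolding core_def by (rule finite_X)
qed

lemma finite_arm: "finite (arm n)" by (simp add: arm_def)

lemma card_arm: "card (arm n) = n - width" by (simp add: arm_def card_cartesian_product)

lemma card_core: "card core = width + sum_list lam"
  using shape.card_cells[OF shape_Cons[of width]] by (simp add: core_def)

lemma fst_arm: "x \<in> arm n \<Longrightarrow> fst x = 0" by (auto simp: arm_def)


definition core_col_group :: "(nat \<times> nat \<Rightarrow> nat \<times> nat) set" where
  "core_col_group = {q. q permutes core \<and> snd \<circ> q = snd}"

text \<open>
Each column to the right of the core has a single cell, which a column permutation must fix.
\<close>

lemma col_group_Cons:
  assumes n: "width \<le> n"
  shows "column_diagram.col_group (cells (n # lam)) = core_col_group"
proof -
  interpret shape "n # lam" by (rule shape_Cons[OF n])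
  show ?thesis
  proof (intro equalityI subsetI)
    fix q assume "q \<in> core_col_group"
    then have q: "q permutes core" "snd \<circ> q = snd" by (simp_all add: core_col_group_def)
    have "q permutes cells (n # lam)"
      unfolding cells_Cons[OF n] by (rule permutes_subset[OF q(1)]) simp
    then show "q \<in> col_group" using q(2) by (simp add: col_group_def)
  next
    fix q assume q: "q \<in> col_group"
    have "q permutes core"
    proof (rule permutes_superset[OF col_groupD(1)[OF q]])
      fix x assume x: "x \<in> cells (n # lam) - core"
      then have xa: "x \<in> arm n" by (auto simp: cells_Cons[OF n])
      have sq: "snd (q x) = snd x" by (rule col_groupD(2)[OF q])
      have "q x \<notin> core"
      proof
        assume "q x \<in> core"
        then have "(fst (q x), snd (q x)) \<in> core" by (simp only: prod.collapse)
        from core_snd[OF this] show False using sq xa by (auto simp: arm_def)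
      qed
      moreover have "q x \<in> cells (n # lam)" using x permutes_in_image[OF col_groupD(1)[OF q]] by blast
      ultimately have "q x \<in> arm n" by (auto simp: cells_Cons[OF n])
      then show "q x = x" using sq xa by (intro prod_eqI) (simp_all add: fst_arm)
    qed
    then show "q \<in> core_col_group" using q by (simp add: core_col_group_def col_group_def)
  qed
qed

lemma core_col_group_fixes_arm: "q permutes core \<Longrightarrow> x \<in> arm n \<Longrightarrow> q x = x"
  using core_arm_disjoint[of n] permutes_not_in[of q core x] by blast

text \<open>
The condition that \<open>inv q \<circ> v\<close> and \<open>v \<circ> q'\<close> preserve rows, in terms of the overlap \<open>r\<close> of \<open>v\<close>, with
\<open>u = inv q\<close> and \<open>u' = inv q'\<close>.
\<close>

definition row_compatible ::
    "(nat \<times> nat \<Rightarrow> nat \<times> nat) \<Rightarrow> (nat \<times> nat \<Rightarrow> nat \<times> nat) \<Rightarrow> ((nat \<times> nat) \<times> (nat \<times> nat)) set \<Rightarrow> bool" where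
  "row_compatible u u' r \<longleftrightarrow>
    ((\<forall>(x, a)\<in>r. fst (u a) = fst x) \<and> (\<forall>x\<in>core - Domain r. fst x = 0) \<and> (\<forall>a\<in>core - Range r. fst (u a) = 0)) \<and>
    ((\<forall>(x, a)\<in>r. fst a = fst (u' x)) \<and> (\<forall>x\<in>core - Domain r. fst (u' x) = 0) \<and> (\<forall>a\<in>core - Range r. fst a = 0))"

lemma young_scalar_poly:
  "\<exists>P :: rat poly. \<forall>n\<ge>width. of_int (column_diagram.young_scalar (cells (n # lam))) =
     fact (n - width) * poly P (of_nat (n - width))"
proof -
  define Q where "Q q q' = overlap_poly core core (row_compatible (inv q) (inv q'))" for q q'
  let ?P = "\<Sum>q\<in>core_col_group. \<Sum>q'\<in>core_col_group. smult (of_int (sign q * sign q')) (Q q q')"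
  show ?thesis
  proof (intro exI[of _ ?P] allI impI)
    fix n assume n: "width \<le> n"
    interpret shape "n # lam" by (rule shape_Cons[OF n])
    let ?X = "core \<union> arm n"
    have X: "cells (n # lam) = ?X" by (rule cells_Cons[OF n])
    have C: "col_group = core_col_group" by (rule col_group_Cons[OF n])
    have "rat_of_nat (card {v. v permutes cells (n # lam) \<and> inv q \<circ> v \<in> row_group \<and> v \<circ> q' \<in> row_group}) =
        fact (n - width) * poly (Q q q') (of_nat (n - width))"
      if q: "q \<in> core_col_group" and q': "q' \<in> core_col_group" for q q'
    proof -
      have qc: "q permutes core" "q' permutes core" using q q' by (auto simp: core_col_group_def)
      have qX: "q permutes ?X" "q' permutes ?X" using qc by (auto intro: permutes_subset)
      have arm: "fst (inv q x) = 0" "fst (inv q' x) = 0" if "x \<in> arm n" for x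
        using core_col_group_fixes_arm[OF permutes_inv that] qc fst_arm[OF that] by simp_all
      have "inv q \<circ> v \<in> row_group \<and> v \<circ> q' \<in> row_group \<longleftrightarrow> row_compatible (inv q) (inv q') (overlap core core v)"
        if v: "v \<in> bijs (\<lambda>x. x) ?X ?X" for v
      proof -
        have vX: "v permutes ?X" using v by (simp flip: permutes_eq_bijs)
        have "inv q \<circ> v \<in> row_group \<longleftrightarrow> (\<forall>x\<in>?X. fst (inv q (v x)) = fst x)"
          using row_group_iff[of "inv q \<circ> v"] permutes_compose[OF vX permutes_inv[OF qX(1)]] by (simp add: X)
        also have "\<dots> \<longleftrightarrow> (\<forall>(x, a)\<in>overlap core core v. fst (inv q a) = fst x) \<and>
            (\<forall>x\<in>core - Domain (overlap core core v). fst x = 0) \<and>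
            (\<forall>a\<in>core - Range (overlap core core v). fst (inv q a) = 0)"
          by (rule bijs_invariant_iff_overlap[OF v core_arm_disjoint core_arm_disjoint fst_arm arm(1)])
        finally have 1: "inv q \<circ> v \<in> row_group \<longleftrightarrow> \<dots>" .
        have "v \<circ> q' \<in> row_group \<longleftrightarrow> (\<forall>x\<in>?X. fst (v (q' x)) = fst x)"
          using row_group_iff[of "v \<circ> q'"] permutes_compose[OF qX(2) vX] by (simp add: X)
        also have "\<dots> \<longleftrightarrow> (\<forall>x\<in>?X. fst (v x) = fst (inv q' x))"
        proof
          assume *: "\<forall>x\<in>?X. fst (v (q' x)) = fst x"
          show "\<forall>x\<in>?X. fst (v x) = fst (inv q' x)"
          proof
            fix x assume "x \<in> ?X"
            then have "inv q' x \<in> ?X" by (simp only: permutes_in_image[OF permutes_inv[OF qX(2)]])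
            from bspec[OF * this] show "fst (v x) = fst (inv q' x)"
              by (simp add: permutes_inverses(1)[OF qX(2)])
          qed
        next
          assume *: "\<forall>x\<in>?X. fst (v x) = fst (inv q' x)"
          show "\<forall>x\<in>?X. fst (v (q' x)) = fst x"
          proof
            fix x assume "x \<in> ?X"
            then have "q' x \<in> ?X" by (simp only: permutes_in_image[OF qX(2)])
            from bspec[OF * this] show "fst (v (q' x)) = fst x"
              by (simp add: permutes_inverses(2)[OF qX(2)])
          qed
        qed
        also have "\<dots> \<longleftrightarrow> (\<forall>(x, a)\<in>overlap core core v. fst a = fst (inv q' x)) \<and>
            (\<forall>x\<in>core - Domain (overlap core core v). fst (inv q' x) = 0) \<and>
            (\<forall>a\<in>core - Range (overlap core core v). fst a = 0)"
          by (rule bijs_invariant_iff_overlap[OF v core_arm_disjoint core_arm_disjoint arm(2) fst_arm])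
        finally have 2: "v \<circ> q' \<in> row_group \<longleftrightarrow> \<dots>" .
        show ?thesis unfolding 1 2 row_compatible_def ..
      qed
      moreover have "v permutes cells (n # lam) \<longleftrightarrow> v \<in> bijs (\<lambda>x. x) ?X ?X" for v
        unfolding X permutes_eq_bijs[symmetric] by simp
      ultimately have "{v. v permutes cells (n # lam) \<and> inv q \<circ> v \<in> row_group \<and> v \<circ> q' \<in> row_group} =
          {v \<in> bijs (\<lambda>x. x) ?X ?X. row_compatible (inv q) (inv q') (overlap core core v)}"
        by blast
      then show ?thesis
        unfolding Q_def
        by (simp add: card_bijs_overlap_poly finite_core finite_arm core_arm_disjoint card_arm)
    qed
    then have "rat_of_int young_scalar = (\<Sum>q\<in>core_col_group. \<Sum>q'\<in>core_col_group.
        of_int (sign q * sign q') * (fact (n - width) * poly (Q q q') (of_nat (n - width))))"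
      unfolding young_scalar_eq_count C of_int_sum of_int_mult of_int_of_nat_eq
      by (intro sum.cong refl) simp
    also have "\<dots> = fact (n - width) * poly ?P (of_nat (n - width))"
      by (simp add: poly_sum sum_distrib_left mult_ac)
    finally show "rat_of_int young_scalar = fact (n - width) * poly ?P (of_nat (n - width))" .
  qed
qed

lemma fixed_tableaux_poly:
  assumes g: "g permutes {1..m}"
  shows "\<exists>P :: rat poly. \<forall>n\<ge>width. m \<le> n + sum_list lam \<longrightarrow>
     of_int (\<Sum>q\<in>core_col_group. sign q * int (card (shape.fixed_tableaux (n # lam) g q))) =
       fact (n + sum_list lam - m) * poly P (of_nat (n - width))"
proof -
  define fits where "fits q r \<longleftrightarrow>
    (\<forall>x\<in>core. q x \<notin> Domain r \<longrightarrow> fst (q x) = fst x) \<and>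
    (\<forall>x\<in>core. \<forall>a. (q x, a) \<in> r \<longrightarrow>
       (\<forall>y. (y, g a) \<in> r \<longrightarrow> fst y = fst x) \<and> (g a \<notin> Range r \<longrightarrow> fst x = 0)) \<and>
    (\<forall>a\<in>{1..m}. a \<notin> Range r \<longrightarrow> (\<forall>y. (y, g a) \<in> r \<longrightarrow> fst y = 0))"
    for q and r :: "((nat \<times> nat) \<times> nat) set"
  define Q where "Q q = overlap_poly core {1..m} (fits q)" for q
  let ?P = "\<Sum>q\<in>core_col_group. smult (of_int (sign q)) (Q q)"
  show ?thesis
  proof (intro exI[of _ ?P] allI impI)
    fix n assume n: "width \<le> n" and m: "m \<le> n + sum_list lam"
    interpret shape "n # lam" by (rule shape_Cons[OF n])
    let ?B' = "{m + 1..n + sum_list lam}"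
    have split: "{1..N} = {1..m} \<union> ?B'" using m by auto
    have "rat_of_nat (card (fixed_tableaux g q)) = fact (n + sum_list lam - m) * poly (Q q) (of_nat (n - width))"
      if q: "q \<in> core_col_group" for q
    proof -
      have qc: "q permutes core" using q by (auto simp: core_col_group_def)
      have disj: "{1..m} \<inter> ?B' = {}" by auto
      have "fixed_tableaux g q = {t \<in> bijs (\<lambda>_. 0) (core \<union> arm n) ({1..m} \<union> ?B').
          \<forall>x\<in>core \<union> arm n. \<forall>y\<in>core \<union> arm n. t y = g (t (q x)) \<longrightarrow> fst y = fst x}"
        unfolding fixed_tableaux_def tableaux_def cells_Cons[OF n] split ..
      also have "\<dots> = {t \<in> bijs (\<lambda>_. 0) (core \<union> arm n) ({1..m} \<union> ?B'). fits q (overlap core {1..m} t)}"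
      proof (intro Collect_cong conj_cong refl)
        fix t :: "nat \<times> nat \<Rightarrow> nat" assume t: "t \<in> bijs (\<lambda>_. 0) (core \<union> arm n) ({1..m} \<union> ?B')"
        show "(\<forall>x\<in>core \<union> arm n. \<forall>y\<in>core \<union> arm n. t y = g (t (q x)) \<longrightarrow> fst y = fst x) \<longleftrightarrow>
            fits q (overlap core {1..m} t)"
          unfolding fits_def by (rule bijs_fixed_iff_overlap[OF t core_arm_disjoint disj fst_arm qc g])
      qed
      finally have "rat_of_nat (card (fixed_tableaux g q)) =
          rat_of_nat (card {t \<in> bijs (\<lambda>_. 0) (core \<union> arm n) ({1..m} \<union> ?B'). fits q (overlap core {1..m} t)})" by simp
      also have "\<dots> = fact (card ?B') * poly (Q q) (of_nat (card (arm n)))"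
        unfolding Q_def using n m
        by (intro card_bijs_overlap_poly finite_core finite_arm core_arm_disjoint disj) (auto simp: card_core card_arm)
      finally show ?thesis by (simp add: card_arm)
    qed
    then have "rat_of_int (\<Sum>q\<in>core_col_group. sign q * int (card (fixed_tableaux g q))) =
        (\<Sum>q\<in>core_col_group. of_int (sign q) * (fact (n + sum_list lam - m) * poly (Q q) (of_nat (n - width))))"
      unfolding of_int_sum of_int_mult of_int_of_nat_eq by (intro sum.cong refl) simp
    also have "\<dots> = fact (n + sum_list lam - m) * poly ?P (of_nat (n - width))"
      by (simp add: poly_sum sum_distrib_left mult_ac)
    finally show "rat_of_int (\<Sum>q\<in>core_col_group. sign q * int (card (fixed_tableaux g q))) =
        fact (n + sum_list lam - m) * poly ?P (of_nat (n - width))" .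
  qed
qed

end

section \<open>Integer-valued rational functions\<close>

lemma ex_common_denominator:
  fixes p :: "rat poly"
  shows "\<exists>M > 0. \<forall>n :: nat. of_int M * poly p (of_nat n) \<in> \<int>"
proof (induction p)
  case 0
  then show ?case by (intro exI[of _ 1]) simp
next
  case (pCons a p)
  then obtain M where M: "M > 0" "\<And>n :: nat. of_int M * poly p (of_nat n) \<in> \<int>" by blast
  obtain x y where a: "a = of_int x / of_int y" "y > 0" by (cases a) (auto simp: Fract_of_int_quotient)
  have "of_int (M * y) * poly (pCons a p) (of_nat n) \<in> \<int>" for n :: nat
  proof -
    have "of_int (M * y) * poly (pCons a p) (of_nat n) =
        of_int (M * x) + of_int y * of_nat n * (of_int M * poly p (of_nat n))"
      using a(2) by (simp add: a(1) field_simps)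
    also have "\<dots> \<in> \<int>" by (intro Ints_add Ints_mult M) auto
    finally show ?thesis .
  qed
  then show ?case using M a by (intro exI[of _ "M * y"]) auto
qed

lemma poly_map_of_rat: "poly (map_poly of_rat p) (of_rat x) = (of_rat (poly p x) :: real)"
  by (induction p) (auto simp: map_poly_pCons of_rat_add of_rat_mult)

text \<open>
Divide with remainder, \<open>E = p D + R\<close>. If \<open>M\<close> is a common denominator for \<open>p\<close>, then \<open>M R(n) / D(n)\<close> is an
integer for large \<open>n\<close> and tends to 0, so \<open>R(n) = 0\<close> for all large \<open>n\<close>.
\<close>

lemma integer_valued_quotient_is_poly:
  fixes D E :: "rat poly" and z :: "nat \<Rightarrow> int"
  assumes D: "D \<noteq> 0"
    and eq: "\<And>n. n \<ge> n0 \<Longrightarrow> of_int (z n) * poly D (of_nat n) = poly E (of_nat n)"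
  shows "D dvd E"
proof (rule ccontr)
  assume "\<not> D dvd E"
  define p R where "p = E div D" and "R = E mod D"
  have R: "R \<noteq> 0" using \<open>\<not> D dvd E\<close> by (simp add: R_def dvd_eq_mod_eq_0)
  have E: "E = p * D + R" by (simp add: p_def R_def)
  have deg: "degree R < degree D" using degree_mod_less'[OF D] R by (simp add: R_def)
  obtain M where M: "M > 0" "\<And>n :: nat. of_int M * poly p (of_nat n) \<in> \<int>"
    using ex_common_denominator by blast
  define D' R' :: "real poly" where "D' = map_poly of_rat D" and "R' = smult (of_int M) (map_poly of_rat R)"
  have polyD': "poly D' (of_nat n) = of_rat (poly D (of_nat n))" for n
    using poly_map_of_rat[of D "of_nat n"] by (simp add: D'_def)
  have polyR': "poly R' (of_nat n) = of_int M * of_rat (poly R (of_nat n))" for n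
    using poly_map_of_rat[of R "of_nat n"] by (simp add: R'_def)
  have "degree R' < degree D'" using deg M(1) by (simp add: D'_def R'_def degree_map_poly)
  then have "((\<lambda>x. poly R' x / poly D' x) \<longlongrightarrow> 0) at_infinity"
    by (rule poly_divide_tendsto_0_at_infinity)
  then have "(\<lambda>n. poly R' (real n) / poly D' (real n)) \<longlonglongrightarrow> 0"
    by (rule filterlim_compose) (rule tendsto_of_nat)
  then have "eventually (\<lambda>n. dist (poly R' (real n) / poly D' (real n)) 0 < 1) sequentially"
    by (rule tendstoD) simp
  then obtain N where N: "\<And>n. n \<ge> N \<Longrightarrow> \<bar>poly R' (real n) / poly D' (real n)\<bar> < 1"
    by (auto simp: eventually_sequentially)
  have zero: "poly (R * D) (of_nat n) = 0" if n: "n \<ge> max n0 N" for n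
  proof (cases "poly D (of_nat n) = 0")
    case False
    obtain k where k: "of_int M * poly p (of_nat n) = of_int k" using M(2)[of n] by (auto elim: Ints_cases)
    have "of_int (z n) * poly D (of_nat n) = poly p (of_nat n) * poly D (of_nat n) + poly R (of_nat n)"
      using eq[of n] n by (simp add: E)
    then have "of_int M * (of_int (z n) * poly D (of_nat n)) =
        (of_int M * poly p (of_nat n)) * poly D (of_nat n) + of_int M * poly R (of_nat n)"
      by (simp add: algebra_simps)
    then have "of_int M * poly R (of_nat n) = of_int (M * z n - k) * poly D (of_nat n)"
      by (simp add: k algebra_simps)
    then have "of_rat (of_int M * poly R (of_nat n)) = (of_rat (of_int (M * z n - k) * poly D (of_nat n)) :: real)"
      by simp
    then have "poly R' (real n) = of_int (M * z n - k) * poly D' (real n)"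
      by (simp only: of_rat_mult of_rat_of_int_eq polyD' polyR')
    note R'_eq = this
    have "poly D' (real n) \<noteq> 0" using False by (simp add: polyD')
    with R'_eq have "poly R' (real n) / poly D' (real n) = of_int (M * z n - k)" by simp
    with N[of n] n have "of_int \<bar>M * z n - k\<bar> < (1 :: real)" by simp
    then have "\<bar>M * z n - k\<bar> < 1" by (simp only: of_int_less_1_iff)
    then have "poly R' (real n) = 0" using R'_eq by simp
    then have "poly R (of_nat n) = 0" using M(1) by (simp add: polyR')
    then show ?thesis by simp
  qed simp
  have "infinite (of_nat ` {max n0 N..} :: rat set)"
    by (subst finite_image_iff) (auto simp: inj_on_def infinite_Ici)
  moreover have "of_nat ` {max n0 N..} \<subseteq> {x. poly (R * D) x = 0}"
    by (intro image_subsetI CollectI zero) simp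
  ultimately have "infinite {x. poly (R * D) x = 0}" using finite_subset by blast
  then show False using poly_roots_finite[of "R * D"] R D by simp
qed

lemma fact_shift_poly:
  "\<exists>W :: rat poly. \<forall>n\<ge>a. fact (n - a + j) = fact (n - a) * poly W (of_nat n) \<and> poly W (of_nat n) \<noteq> 0"
proof (induction j)
  case 0
  show ?case by (intro exI[of _ 1]) simp
next
  case (Suc j)
  then obtain W :: "rat poly" where W: "\<And>n. n \<ge> a \<Longrightarrow> fact (n - a + j) = fact (n - a) * poly W (of_nat n) \<and> poly W (of_nat n) \<noteq> 0"
    by blast
  show ?case
  proof (intro exI[of _ "W * [:of_nat (Suc j) - of_nat a, 1:]"] allI impI)
    fix n assume n: "n \<ge> a"
    have lin: "poly [:of_nat (Suc j) - of_nat a, 1:] (rat_of_nat n) = of_nat (Suc (n - a + j))"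
      using n by (simp add: of_nat_diff)
    have "poly [:of_nat (Suc j) - of_nat a, 1:] (rat_of_nat n) \<noteq> 0"
      unfolding lin by (rule of_nat_neq_0)
    moreover have "(fact (n - a + Suc j) :: rat) = of_nat (Suc (n - a + j)) * fact (n - a + j)"
      by (simp only: add_Suc_right fact_Suc)
    ultimately show "fact (n - a + Suc j) = fact (n - a) * poly (W * [:of_nat (Suc j) - of_nat a, 1:]) (of_nat n) \<and>
        poly (W * [:of_nat (Suc j) - of_nat a, 1:]) (rat_of_nat n) \<noteq> 0"
      using W[OF n] unfolding poly_mult lin by (simp add: mult_ac)
  qed
qed

text \<open>
The ratio of the two factorials is a polynomial or the inverse of one, according to the sign of
the constant difference \<open>k + l - m\<close> of their arguments.
\<close>

lemma fact_ratio_poly: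
  "\<exists>U V :: rat poly. \<forall>n. l \<le> n \<and> m \<le> n + k \<longrightarrow>
     fact (n + k - m) * poly V (of_nat n) = fact (n - l) * poly U (of_nat n) \<and> poly V (of_nat n) \<noteq> 0"
proof (cases "m \<le> k + l")
  case True
  obtain W :: "rat poly" where W: "\<And>n. n \<ge> l \<Longrightarrow>
      fact (n - l + (k + l - m)) = fact (n - l) * poly W (of_nat n)"
    using fact_shift_poly[of l "k + l - m"] by blast
  show ?thesis
  proof (rule exI[of _ W], rule exI[of _ 1], intro allI impI conjI)
    fix n assume n: "l \<le> n \<and> m \<le> n + k"
    then have "n + k - m = n - l + (k + l - m)" using True by simp
    then have "fact (n + k - m) = fact (n - l) * poly W (of_nat n)" using W n by (simp only:)
    then show "fact (n + k - m) * poly 1 (rat_of_nat n) = fact (n - l) * poly W (rat_of_nat n)" by simp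
  qed simp
next
  case False
  obtain W :: "rat poly" where W: "\<And>n. n \<ge> m - k \<Longrightarrow>
      fact (n - (m - k) + (m - k - l)) = fact (n - (m - k)) * poly W (of_nat n) \<and> poly W (of_nat n) \<noteq> 0"
    using fact_shift_poly[of "m - k" "m - k - l"] by blast
  have "n - l = n - (m - k) + (m - k - l)" "n + k - m = n - (m - k)" "m - k \<le> n" if "l \<le> n" "m \<le> n + k" for n
    using that False by simp_all
  note eqs = this
  show ?thesis
  proof (rule exI[of _ 1], rule exI[of _ W], intro allI impI)
    fix n assume "l \<le> n \<and> m \<le> n + k"
    then have n: "l \<le> n" "m \<le> n + k" by simp_all
    from W[OF eqs(3)[OF n]] have "fact (n - l) = fact (n - (m - k)) * poly W (of_nat n) \<and> poly W (of_nat n) \<noteq> 0"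
      unfolding eqs(1)[OF n, symmetric] .
    then show "fact (n + k - m) * poly W (of_nat n) = fact (n - l) * poly 1 (rat_of_nat n) \<and> poly W (rat_of_nat n) \<noteq> 0"
      unfolding eqs(2)[OF n] by simp
  qed
qed

section \<open>Polynomiality of the character values\<close>

theorem proposition3p3:
  fixes lam nu :: "nat list" and k m :: nat
  assumes "is_partition lam k" and "is_partition nu m"
  shows "\<exists>p :: rat poly. \<forall>n :: nat. (lam \<noteq> [] \<longrightarrow> hd lam \<le> n) \<and> m \<le> n + k \<longrightarrow>
           irr_char_at (n # lam) (nu @ replicate (n + k - m) 1) = of_rat (poly p (of_nat n))"
proof -
  interpret shape_tail lam using assms(1) by unfold_locales (simp add: is_partition_def)
  have k: "sum_list lam = k" using assms(1) by (simp add: is_partition_def)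
  have nu: "0 \<notin> set nu" "sum_list nu = m" using assms(2) by (auto simp: is_partition_def)
  obtain g where g: "g permutes {1..m}" "cycle_type m g = mset nu"
    using ex_permutation_cycle_type[OF nu(1)] nu(2) by auto
  obtain P :: "rat poly" where P: "\<And>n. n \<ge> width \<Longrightarrow>
      of_int (column_diagram.young_scalar (cells (n # lam))) = fact (n - width) * poly P (of_nat (n - width))"
    using young_scalar_poly by blast
  obtain Q :: "rat poly" where Q: "\<And>n. n \<ge> width \<Longrightarrow> m \<le> n + k \<Longrightarrow>
      of_int (\<Sum>q\<in>core_col_group. sign q * int (card (shape.fixed_tableaux (n # lam) g q))) =
        fact (n + k - m) * poly Q (of_nat (n - width))"
    using fixed_tableaux_poly[OF g(1)] unfolding k by blast
  obtain U V :: "rat poly" where UV: "\<And>n. width \<le> n \<Longrightarrow> m \<le> n + k \<Longrightarrow>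
     fact (n + k - m) * poly V (of_nat n) = fact (n - width) * poly U (of_nat n) \<and> poly V (of_nat n) \<noteq> 0"
    using fact_ratio_poly[of width m k] by blast
  define shift :: "rat poly" where "shift = [:- of_nat width, 1:]"
  \<comment> \<open>numerator and denominator of the character value, after the factorials have been cancelled\<close>
  define D where "D = pcompose P shift * V"
  define E where "E = U * pcompose Q shift"
  have shift: "poly shift (of_nat n) = of_nat (n - width)" if "width \<le> n" for n
    using that by (simp add: shift_def of_nat_diff)
  have main: "\<exists>z. irr_char_at (n # lam) (nu @ replicate (n + k - m) 1) = of_int z \<and>
      of_int z * poly D (of_nat n) = poly E (of_nat n) \<and> poly D (of_nat n) \<noteq> 0"
    if n: "width \<le> n" and m: "m \<le> n + k" for n
  proof -
    interpret shape "n # lam" by (rule shape_Cons[OF n])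
    have N: "N = m + (n + k - m)" using m k by simp
    have gN: "g permutes {1..N}" by (rule permutes_subset[OF g(1)]) (use N in auto)
    have "cycle_type N g = mset (nu @ replicate (n + k - m) 1)"
      unfolding N cycle_type_append_fixpoints[OF g(1)] by (simp add: g(2))
    from irr_char_at_eq[OF gN this]
    have at: "irr_char_at (n # lam) (nu @ replicate (n + k - m) 1) = irr_char (n # lam) g" .
    obtain z where z: "irr_char (n # lam) g = of_int z"
      using irr_char_formula(2)[OF gN] by (auto elim: Ints_cases)
    let ?num = "\<Sum>q\<in>core_col_group. sign q * int (card (fixed_tableaux g q))"
    have "(of_int (young_scalar * z) :: complex) = of_int ?num"
      using irr_char_formula(1)[OF gN] unfolding z col_group_Cons[OF n] by simp
    then have "young_scalar * z = ?num" by (simp only: of_int_eq_iff)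
    then have "rat_of_int (young_scalar * z) = of_int ?num" by (simp only:)
    then have "rat_of_int young_scalar * of_int z = of_int ?num" by (simp only: of_int_mult)
    then have eq: "fact (n - width) * poly P (of_nat (n - width)) * of_int z =
        fact (n + k - m) * poly Q (of_nat (n - width))"
      unfolding P[OF n] Q[OF n m] .
    have "fact (n - width) * (of_int z * poly D (of_nat n)) =
        (fact (n - width) * poly P (of_nat (n - width)) * of_int z) * poly V (of_nat n)"
      by (simp add: D_def poly_pcompose shift[OF n])
    also have "\<dots> = (fact (n + k - m) * poly V (of_nat n)) * poly Q (of_nat (n - width))"
      unfolding eq by simp
    also have "\<dots> = fact (n - width) * poly E (of_nat n)"
      using UV[OF n m] by (simp add: E_def poly_pcompose shift[OF n])
    finally have "of_int z * poly D (of_nat n) = poly E (of_nat n)" by simp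
    moreover have "poly P (of_nat (n - width)) \<noteq> 0"
    proof
      assume "poly P (of_nat (n - width)) = 0"
      then have "rat_of_int young_scalar = 0" using P[OF n] by simp
      then show False using young_scalar_pos by simp
    qed
    then have "poly D (of_nat n) \<noteq> 0"
      using UV[OF n m] by (simp add: D_def poly_pcompose shift[OF n])
    ultimately show ?thesis using at z by auto
  qed
  then have "\<forall>n. \<exists>z. width \<le> n \<longrightarrow> m \<le> n + k \<longrightarrow>
      irr_char_at (n # lam) (nu @ replicate (n + k - m) 1) = of_int z \<and>
      of_int z * poly D (of_nat n) = poly E (of_nat n) \<and> poly D (of_nat n) \<noteq> 0"
    by blast
  from choice[OF this] obtain z where z: "\<And>n. width \<le> n \<Longrightarrow> m \<le> n + k \<Longrightarrow>
      irr_char_at (n # lam) (nu @ replicate (n + k - m) 1) = of_int (z n) \<and>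
      of_int (z n) * poly D (of_nat n) = poly E (of_nat n) \<and> poly D (of_nat n) \<noteq> 0"
    by blast
  have "D \<noteq> 0" using z[of "width + m"] by auto
  then have "D dvd E"
    by (rule integer_valued_quotient_is_poly[where z = z and ?n0.0 = "width + m"]) (use z in auto)
  then obtain p where p: "E = D * p" by (elim dvdE)
  show ?thesis
  proof (intro exI[of _ p] allI impI)
    fix n assume "(lam \<noteq> [] \<longrightarrow> hd lam \<le> n) \<and> m \<le> n + k"
    then have n: "width \<le> n" "m \<le> n + k" by (auto simp: width_def)
    have "of_int (z n) * poly D (of_nat n) = poly E (of_nat n)" using z[OF n] by blast
    then have "of_int (z n) * poly D (of_nat n) = poly p (of_nat n) * poly D (of_nat n)"
      unfolding p poly_mult by (simp only: mult.commute)
    moreover have "poly D (of_nat n) \<noteq> 0" using z[OF n] by blast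
    ultimately have "poly p (of_nat n) = of_int (z n)" by simp
    then show "irr_char_at (n # lam) (nu @ replicate (n + k - m) 1) = of_rat (poly p (of_nat n))"
      using z[OF n] by simp
  qed
qed

end
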